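(* Suppose that $b<1$ and let $c\in\mathbb R$ be fixed. Then, as $N\to\infty$, $$\mathrm{Fix}_c\xrightarrow{\ \mathrm{dist}\ }\mathrm{Poiss}\left(1+\tfrac12 e^{c}\right),$$ and $$d_{\mathrm{TV}}\left(\mathrm{Fix}_c,\mathrm{Fix}\right)\longrightarrow d_{\mathrm{TV}}\left(\mathrm{Poiss}(1),\mathrm{Poiss}\left(1+\tfrac12e^{c}\right)\right).$$
   Context: Let $N=2n$, $[N]=A\sqcup B$ with $|A|=|B|=n$, and fix real numbers $0<b\le a$ with $a+b=2$ (independent of $n$). The biased random transposition shuffle is the random walk on $\mathfrak S_N$, started at the identity, in which at each step two cards of $[N]$ are chosen independently, each card of $A$ with probability $a/N$ and each card of $B$ with probability $b/N$, and swapped (nothing happens if they coincide); i.e. the current permutation $x$ is multiplied on the left by the corresponding transposition (or identity). $\mathrm{Fix}_c$ is the number of fixed points of the permutation after $\frac{1}{2b}N(\log N-c)$ steps (a non-integer number of steps is rounded down). $\mathrm{Fix}$ is the number of fixed points of a uniformly random permutation in $\mathfrak S_N$. $\mathrm{Poiss}(r)$ is the Poisson distribution of rate $r$, and $d_{\mathrm{TV}}$ is the total variation distance $\frac12\sum_k|p(k)-q(k)|$ between the laws. *)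

theory Defs
  imports "HOL-Probability.Probability"
begin

(* The random card chosen in each half of a step. The weights form a probability mass function
   (so that embed_pmf is meaningful) under the standing assumptions; see pmf_biased_card. *)
definition biased_card :: "real \<Rightarrow> real \<Rightarrow> nat \<Rightarrow> nat set \<Rightarrow> nat set \<Rightarrow> nat pmf" where
  "biased_card a b N A B =
     embed_pmf (\<lambda>x. if x \<in> A then a / real N else if x \<in> B then b / real N else 0)"

lemma pmf_biased_card:
  assumes "0 < a" "0 < b" "a + b = 2" "0 < n"
    and "A \<inter> B = {}" "A \<union> B = {1..2 * n}" "card A = n" "card B = n"
  shows "pmf (biased_card a b (2 * n) A B) x =
    (if x \<in> A then a / real (2 * n) else if x \<in> B then b / real (2 * n) else 0)"
proof -
  let ?f = "\<lambda>x. if x \<in> A then a / real (2 * n) else if x \<in> B then b / real (2 * n) else 0"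
  have fin: "finite A" "finite B"
    using assms(6) by (metis finite_Un finite_atLeastAtMost)+
  have nn: "0 \<le> ?f x" for x using assms by auto
  have "(\<integral>\<^sup>+x. ennreal (?f x) \<partial>count_space UNIV) = (\<Sum>x\<in>A \<union> B. ennreal (?f x))"
    by (rule nn_integral_count_space') (use fin in auto)
  also have "\<dots> = ennreal (\<Sum>x\<in>A \<union> B. ?f x)"
    using nn by (intro sum_ennreal) auto
  also have "(\<Sum>x\<in>A \<union> B. ?f x) = (\<Sum>x\<in>A. ?f x) + (\<Sum>x\<in>B. ?f x)"
    using fin assms by (intro sum.union_disjoint) auto
  also have "(\<Sum>x\<in>A. ?f x) = (\<Sum>x\<in>A. a / real (2 * n))"
    by (intro sum.cong) auto
  also have "(\<Sum>x\<in>B. ?f x) = (\<Sum>x\<in>B. b / real (2 * n))"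
    using assms by (intro sum.cong) auto
  also have "(\<Sum>x\<in>A. a / real (2 * n)) + (\<Sum>x\<in>B. b / real (2 * n)) = (a + b) / 2"
    using assms by (simp add: field_simps)
  finally have "(\<integral>\<^sup>+x. ennreal (?f x) \<partial>count_space UNIV) = 1"
    using assms by simp
  then show ?thesis
    unfolding biased_card_def by (subst pmf_embed_pmf) (use nn in auto)
qed

definition shuffle_step ::
    "real \<Rightarrow> real \<Rightarrow> nat \<Rightarrow> nat set \<Rightarrow> nat set \<Rightarrow> (nat \<Rightarrow> nat) \<Rightarrow> (nat \<Rightarrow> nat) pmf" where
  "shuffle_step a b N A B \<sigma> =
     map_pmf (\<lambda>(i, j). Transposition.transpose i j \<circ> \<sigma>)
       (pair_pmf (biased_card a b N A B) (biased_card a b N A B))"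

primrec shuffle ::
    "real \<Rightarrow> real \<Rightarrow> nat \<Rightarrow> nat set \<Rightarrow> nat set \<Rightarrow> nat \<Rightarrow> (nat \<Rightarrow> nat) pmf" where
  "shuffle a b N A B 0 = return_pmf id"
| "shuffle a b N A B (Suc t) = bind_pmf (shuffle a b N A B t) (shuffle_step a b N A B)"

definition num_fixed :: "nat \<Rightarrow> (nat \<Rightarrow> nat) \<Rightarrow> nat" where
  "num_fixed N \<sigma> = card {i \<in> {1..N}. \<sigma> i = i}"

(* For the finitely many N with log N < c the number of steps is truncated to 0. *)
definition num_steps :: "real \<Rightarrow> real \<Rightarrow> nat \<Rightarrow> nat" where
  "num_steps b c N = nat \<lfloor>1 / (2 * b) * real N * (ln (real N) - c)\<rfloor>"

definition Fix_shuffle :: "real \<Rightarrow> real \<Rightarrow> real \<Rightarrow> nat \<Rightarrow> nat set \<Rightarrow> nat set \<Rightarrow> nat pmf" where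
  "Fix_shuffle a b c N A B = map_pmf (num_fixed N) (shuffle a b N A B (num_steps b c N))"

definition Fix_unif :: "nat \<Rightarrow> nat pmf" where
  "Fix_unif N = map_pmf (num_fixed N) (pmf_of_set {\<sigma>. \<sigma> permutes {1..N}})"

definition d_TV :: "nat pmf \<Rightarrow> nat pmf \<Rightarrow> real" where
  "d_TV p q = 1 / 2 * (\<Sum>k. \<bar>pmf p k - pmf q k\<bar>)"

definition converges_in_dist :: "(nat \<Rightarrow> nat pmf) \<Rightarrow> nat pmf \<Rightarrow> bool" where
  "converges_in_dist p q \<longleftrightarrow>
     weak_conv_m (\<lambda>n. distr (measure_pmf (p n)) borel real) (distr (measure_pmf q) borel real)"

end

theory Submission
  imports Defs "HOL-Real_Asymp.Real_Asymp"
begin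

text \<open>
  The binomial moments of the number of fixed points are the sums, over the \<open>k\<close>-subsets \<open>S\<close> of the deck,
  of the probability that the walk fixes \<open>S\<close> pointwise; we show that they converge to \<open>\<lambda>\<^sup>k / k!\<close> with
  \<open>\<lambda> = 1 + e\<^sup>c / 2\<close>, and Bonferroni's inequalities turn this into convergence of the point probabilities,
  hence of the total variation distances.

  Upper bound: \<open>k\<close> tracked cards move almost like independent one-card chains. Entrywise domination of
  transition matrices bounds the return probability by the product of the one-card return probabilities, up
  to an error for direct exchanges of two tracked cards, which is controlled by the same product summed over
  all permutations of the targets. The one-card chain is diagonalised explicitly, and its trace
  tends to \<open>\<lambda>\<close>: the eigenvalue \<open>1\<close> gives \<open>1\<close>, and the \<open>n - 1\<close> eigenvalues \<open>1 - b / n\<close> belonging to cards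
  of \<open>B\<close> that are still untouched give \<open>e\<^sup>c / 2\<close>.

  Lower bound: the walk is symmetric, so returning in \<open>2 s\<close> steps has the probability that two independent
  copies agree after \<open>s\<close> steps. Splitting according to the set \<open>S\<close> of tracked cards fixed after \<open>s\<close> steps and
  applying the Cauchy--Schwarz inequality to each part gives at least
  \<open>P(fixed set is S)\<^sup>2 / N\<^bsup>k - |S|\<^esup>\<close> each, where only \<open>S\<close> contained in \<open>B\<close> matter.
  Cards never chosen are fixed, and the upper bound at the half time
  shows that fixing further cards is negligible.
\<close>

section \<open>From binomial moments to total variation\<close>

lemma pmf_nat_sums: "(\<lambda>k. pmf (r :: nat pmf) k) sums 1"
proof -
  have "integrable (count_space UNIV) (\<lambda>k. pmf r k)" by (rule integrable_pmf)
  then have "(\<lambda>k. pmf r k) sums (\<integral>k. pmf r k \<partial>count_space UNIV)"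
    by (rule sums_integral_count_space_nat)
  also have "(\<integral>k. pmf r k \<partial>count_space UNIV) = 1"
    using integral_pmf[of UNIV r] by simp
  finally show ?thesis .
qed

text \<open>Scheffe's argument: both masses are 1, so the l1 distance is twice the sum of the
  positive parts of \<open>pmf q k - pmf (p n) k\<close>. These are dominated by the summable
  \<open>pmf q k\<close>, and Tannery's theorem applies.\<close>

lemma sum_abs_pmf_diff_tendsto_0:
  fixes p :: "nat \<Rightarrow> nat pmf" and q :: "nat pmf"
  assumes "\<And>k. (\<lambda>n. pmf (p n) k) \<longlonglongrightarrow> pmf q k"
  shows "(\<lambda>n. \<Sum>k. \<bar>pmf (p n) k - pmf q k\<bar>) \<longlonglongrightarrow> 0"
proof -
  have summ: "summable (\<lambda>k. pmf r k)" for r :: "nat pmf" using pmf_nat_sums by (rule sums_summable)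
  let ?g = "\<lambda>n k. max 0 (pmf q k - pmf (p n) k)"
  have sg: "summable (\<lambda>k. ?g n k)" for n
    by (rule summable_comparison_test'[OF summ[of q], of 0]) (auto simp: max_def pmf_nonneg)
  have eq: "(\<Sum>k. \<bar>pmf (p n) k - pmf q k\<bar>) = 2 * (\<Sum>k. ?g n k)" for n
  proof -
    have "(\<lambda>k. 2 * ?g n k + pmf (p n) k - pmf q k) sums (2 * (\<Sum>k. ?g n k) + 1 - 1)"
      by (intro sums_add sums_diff sums_mult pmf_nat_sums summable_sums sg)
    moreover have "(\<lambda>k. 2 * ?g n k + pmf (p n) k - pmf q k) = (\<lambda>k. \<bar>pmf (p n) k - pmf q k\<bar>)"
      by (auto simp: max_def)
    ultimately show ?thesis by (simp add: sums_iff)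
  qed
  have "(\<lambda>n. \<Sum>k. ?g n k) \<longlonglongrightarrow> (\<Sum>k. 0)"
  proof (rule tannerys_theorem[where M = "\<lambda>k. pmf q k" and a = "\<lambda>k n. max 0 (pmf q k - pmf (p n) k)", THEN conjunct2, THEN conjunct2])
    show "((\<lambda>n. ?g n k) \<longlongrightarrow> 0) sequentially" for k
      using tendsto_max[OF tendsto_const[of 0] tendsto_diff[OF tendsto_const[of "pmf q k"] assms[of k]]]
      by simp
    show "\<forall>\<^sub>F (k, n) in at_top \<times>\<^sub>F sequentially. norm (?g n k) \<le> pmf q k"
      by (intro always_eventually) (auto simp: max_def pmf_nonneg)
  qed (auto simp: summ)
  then have "(\<lambda>n. 2 * (\<Sum>k. ?g n k)) \<longlonglongrightarrow> 2 * 0" by (intro tendsto_mult) auto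
  then show ?thesis unfolding eq by simp
qed


lemma summable_abs_pmf_diff: "summable (\<lambda>k. \<bar>pmf (p :: nat pmf) k - pmf q k\<bar>)"
proof (rule summable_comparison_test'[of "\<lambda>k. pmf p k + pmf q k" 0])
  show "summable (\<lambda>k. pmf p k + pmf q k)"
    by (intro summable_add sums_summable[OF pmf_nat_sums])
  show "norm \<bar>pmf p k - pmf q k\<bar> \<le> pmf p k + pmf q k" for k
    using pmf_nonneg[of p k] pmf_nonneg[of q k] unfolding real_norm_def by arith
qed

text \<open>By the triangle inequality, total variation is Lipschitz in each argument for the l1
  distance.\<close>

lemma d_TV_tendsto:
  assumes p: "\<And>k. (\<lambda>n. pmf (p n) k) \<longlonglongrightarrow> pmf P k"
    and q: "\<And>k. (\<lambda>n. pmf (q n) k) \<longlonglongrightarrow> pmf Q k"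
  shows "(\<lambda>n. d_TV (p n) (q n)) \<longlonglongrightarrow> d_TV P Q"
proof -
  have tri: "(\<Sum>k. \<bar>pmf a k - pmf c k\<bar>) \<le> (\<Sum>k. \<bar>pmf a k - pmf b k\<bar>) + (\<Sum>k. \<bar>pmf b k - pmf c k\<bar>)"
    for a b c :: "nat pmf"
    unfolding suminf_add[OF summable_abs_pmf_diff summable_abs_pmf_diff]
    by (intro suminf_le summable_abs_pmf_diff summable_add) auto
  have sym: "(\<Sum>k. \<bar>pmf a k - pmf b k\<bar>) = (\<Sum>k. \<bar>pmf b k - pmf a k\<bar>)" for a b :: "nat pmf"
    by (simp add: abs_minus_commute)
  let ?e = "\<lambda>n. (\<Sum>k. \<bar>pmf (p n) k - pmf P k\<bar>) + (\<Sum>k. \<bar>pmf (q n) k - pmf Q k\<bar>)"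
  have "?e \<longlonglongrightarrow> 0 + 0"
    by (intro tendsto_add sum_abs_pmf_diff_tendsto_0 p q)
  then have e: "?e \<longlonglongrightarrow> 0" by simp
  have "\<bar>d_TV (p n) (q n) - d_TV P Q\<bar> \<le> ?e n" for n
    using tri[of "p n" "q n" P] tri[of P "q n" Q] tri[of P Q "p n"] tri[of "p n" Q "q n"]
      sym[of P "p n"] sym[of Q "q n"] unfolding d_TV_def by argo
  then have "(\<lambda>n. d_TV (p n) (q n) - d_TV P Q) \<longlonglongrightarrow> 0"
    by (intro Lim_null_comparison[OF _ e] always_eventually) simp
  then show ?thesis by (rule LIM_zero_cancel)
qed

lemma measure_pmf_nat_tendsto:
  assumes "\<And>k. (\<lambda>n. pmf (p n) k) \<longlonglongrightarrow> pmf (q :: nat pmf) k"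
  shows "(\<lambda>n. measure_pmf.prob (p n) S) \<longlonglongrightarrow> measure_pmf.prob q S"
proof -
  have ms: "(\<lambda>k. pmf r k * indicator S k) sums measure_pmf.prob r S" for r :: "nat pmf"
  proof -
    have "integrable (count_space UNIV) (\<lambda>k. indicator S k *\<^sub>R pmf r k)"
      by (rule integrable_mult_indicator) (auto intro: integrable_pmf)
    then have "(\<lambda>k. indicator S k *\<^sub>R pmf r k) sums (\<integral>k. indicator S k *\<^sub>R pmf r k \<partial>count_space UNIV)"
      by (rule sums_integral_count_space_nat)
    also have "(\<integral>k. indicator S k *\<^sub>R pmf r k \<partial>count_space UNIV) = (\<integral>k. pmf r k \<partial>count_space S)"
      by (subst integral_restrict_space[symmetric]) (simp_all add: restrict_count_space)
    also have "\<dots> = measure_pmf.prob r S" by (rule integral_pmf)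
    finally show ?thesis by (simp add: mult.commute)
  qed
  have "\<bar>measure_pmf.prob (p n) S - measure_pmf.prob q S\<bar> \<le> (\<Sum>k. \<bar>pmf (p n) k - pmf q k\<bar>)" for n
  proof -
    have s: "(\<lambda>k. pmf (p n) k * indicator S k - pmf q k * indicator S k) sums
        (measure_pmf.prob (p n) S - measure_pmf.prob q S)"
      by (intro sums_diff ms)
    have b: "\<bar>pmf (p n) k * indicator S k - pmf q k * indicator S k\<bar> \<le> \<bar>pmf (p n) k - pmf q k\<bar>" for k
      by (auto simp: indicator_def)
    have "summable (\<lambda>k. \<bar>pmf (p n) k * indicator S k - pmf q k * indicator S k\<bar>)"
      by (rule summable_comparison_test'[OF summable_abs_pmf_diff[of "p n" q], of 0]) (use b in auto)
    then have "\<bar>measure_pmf.prob (p n) S - measure_pmf.prob q S\<bar> \<le>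
        (\<Sum>k. \<bar>pmf (p n) k * indicator S k - pmf q k * indicator S k\<bar>)"
      using summable_rabs[of "\<lambda>k. pmf (p n) k * indicator S k - pmf q k * indicator S k"] s
      by (simp add: sums_iff)
    also have "\<dots> \<le> (\<Sum>k. \<bar>pmf (p n) k - pmf q k\<bar>)"
      by (rule suminf_le) (use b summable_abs_pmf_diff \<open>summable _\<close> in auto)
    finally show ?thesis .
  qed
  then have "(\<lambda>n. measure_pmf.prob (p n) S - measure_pmf.prob q S) \<longlonglongrightarrow> 0"
    by (intro Lim_null_comparison[OF _ sum_abs_pmf_diff_tendsto_0[OF assms]] always_eventually) simp
  then show ?thesis by (rule LIM_zero_cancel)
qed

text \<open>The distribution function at \<open>x\<close> is the probability of a fixed set of
  naturals, so it converges at every \<open>x\<close>, not only at continuity points.\<close>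

lemma converges_in_distI:
  assumes "\<And>k. (\<lambda>n. pmf (p n) k) \<longlonglongrightarrow> pmf q k"
  shows "converges_in_dist p q"
proof -
  have "cdf (distr (measure_pmf r) borel real) x = measure_pmf.prob r {k. real k \<le> x}" for r x
    by (simp add: cdf_def measure_distr vimage_def)
  then show ?thesis
    using measure_pmf_nat_tendsto[OF assms]
    by (simp add: converges_in_dist_def weak_conv_m_def weak_conv_def)
qed

text \<open>With \<open>d = x - j > 0\<close>, trinomial revision factors out
  \<open>x choose j\<close> and leaves an alternating partial sum of row \<open>d\<close>, which up
  to sign is \<open>(d - 1) choose m\<close>. Pascal's rule bounds this by the first omitted term
  \<open>d choose Suc m\<close>.\<close>

lemma binomial_inversion_error:
  fixes x j m :: nat
  shows "\<bar>(if x = j then 1 else 0) - (\<Sum>i\<le>m. (-1) ^ i * real ((j + i) choose j) * real (x choose (j + i)))\<bar>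
    \<le> real ((j + Suc m) choose j) * real (x choose (j + Suc m))"
proof (cases "x \<le> j")
  case True
  have "x choose (j + i) = (if x = j \<and> i = 0 then 1 else 0)" for i using True by auto
  then have "(\<Sum>i\<le>m. (-1) ^ i * real ((j + i) choose j) * real (x choose (j + i))) =
     (\<Sum>i\<le>m. if i = 0 then (if x = j then 1 else 0) else 0)"
    by (intro sum.cong) auto
  then show ?thesis by simp
next
  case False
  define d where "d = x - j"
  have x: "x = j + d" "d > 0" using False by (auto simp: d_def)
  have c: "real ((j + i) choose j) * real (x choose (j + i)) = real (x choose j) * real (d choose i)" for i
  proof (cases "i \<le> d")
    case True
    then show ?thesis
      using choose_mult[of j "j + i" x] x by (simp flip: of_nat_mult) (simp add: mult.commute)
  next
    case False then show ?thesis using x by (simp add: binomial_eq_0)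
  qed
  have alt: "(\<Sum>i\<le>m. (-1) ^ i * real (d choose i)) = (-1) ^ m * real ((d - 1) choose m)"
    using gbinomial_sum_lower_neg[of "real d" m] x
    by (simp add: binomial_gbinomial mult.commute of_nat_diff)
  have le: "(d - 1) choose m \<le> d choose Suc m"
    using x binomial_Suc_Suc[of "d - 1" m] by simp
  have "(\<Sum>i\<le>m. (-1) ^ i * real ((j + i) choose j) * real (x choose (j + i))) =
     real (x choose j) * (\<Sum>i\<le>m. (-1) ^ i * real (d choose i))"
    unfolding sum_distrib_left by (intro sum.cong) (auto simp: c mult.assoc mult.left_commute)
  then have "\<bar>(if x = j then 1 else 0) - (\<Sum>i\<le>m. (-1) ^ i * real ((j + i) choose j) * real (x choose (j + i)))\<bar>
     = real (x choose j) * real ((d - 1) choose m)"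
    using x alt by (simp add: abs_mult)
  also have "\<dots> \<le> real (x choose j) * real (d choose Suc m)"
    using le by (intro mult_left_mono) auto
  finally show ?thesis unfolding c .
qed

text \<open>Bonferroni's inequalities express the point probabilities through the binomial moments.\<close>

lemma pmf_tendsto_poisson_of_binomial_moments:
  fixes p :: "nat \<Rightarrow> nat pmf"
  assumes fin: "\<And>n. finite (set_pmf (p n))" and r: "r > 0"
    and mom: "\<And>k. (\<lambda>n. measure_pmf.expectation (p n) (\<lambda>x. real (x choose k))) \<longlonglongrightarrow> r ^ k / fact k"
  shows "(\<lambda>n. pmf (p n) j) \<longlonglongrightarrow> pmf (poisson_pmf r) j"
proof -
  define M where "M n k = measure_pmf.expectation (p n) (\<lambda>x. real (x choose k))" for n k
  define T where "T m = (\<Sum>i\<le>m. (-1) ^ i * real ((j + i) choose j) * (r ^ (j + i) / fact (j + i)))" for m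
  define E where "E m = real ((j + Suc m) choose j) * (r ^ (j + Suc m) / fact (j + Suc m))" for m
  have int: "integrable (measure_pmf (p n)) f" for n and f :: "nat \<Rightarrow> real"
    by (rule integrable_measure_pmf_finite[OF fin])
  have bon: "\<bar>pmf (p n) j - (\<Sum>i\<le>m. (-1) ^ i * real ((j + i) choose j) * M n (j + i))\<bar>
     \<le> real ((j + Suc m) choose j) * M n (j + Suc m)" for n m
  proof -
    have "pmf (p n) j = measure_pmf.expectation (p n) (\<lambda>x. if x = j then 1 else 0)"
    proof -
      have "(\<lambda>x. if x = j then 1 else 0) = (indicator {j} :: nat \<Rightarrow> real)" by auto
      then show ?thesis by (simp add: measure_pmf_single)
    qed
    then have "\<bar>pmf (p n) j - (\<Sum>i\<le>m. (-1) ^ i * real ((j + i) choose j) * M n (j + i))\<bar> =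
      \<bar>measure_pmf.expectation (p n) (\<lambda>x. (if x = j then 1 else 0) - (\<Sum>i\<le>m. (-1) ^ i * real ((j + i) choose j) * real (x choose (j + i))))\<bar>"
      by (simp add: M_def int Bochner_Integration.integral_sum)
    also have "\<dots> \<le> measure_pmf.expectation (p n) (\<lambda>x. \<bar>(if x = j then 1 else 0) - (\<Sum>i\<le>m. (-1) ^ i * real ((j + i) choose j) * real (x choose (j + i)))\<bar>)"
      by (rule integral_abs_bound)
    also have "\<dots> \<le> measure_pmf.expectation (p n) (\<lambda>x. real ((j + Suc m) choose j) * real (x choose (j + Suc m)))"
      by (intro integral_mono int binomial_inversion_error)
    also have "\<dots> = real ((j + Suc m) choose j) * M n (j + Suc m)"
      by (simp add: M_def)
    finally show ?thesis .
  qed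
  have lim1: "(\<lambda>n. \<Sum>i\<le>m. (-1) ^ i * real ((j + i) choose j) * M n (j + i)) \<longlonglongrightarrow> T m" for m
    unfolding T_def M_def by (intro tendsto_sum tendsto_mult tendsto_const mom)
  have lim2: "(\<lambda>n. real ((j + Suc m) choose j) * M n (j + Suc m)) \<longlonglongrightarrow> E m" for m
    unfolding E_def M_def by (intro tendsto_mult tendsto_const mom)
  have fc: "real ((j + i) choose j) * (r ^ (j + i) / fact (j + i)) = r ^ j / fact j * (r ^ i / fact i)" for i
    by (simp add: binomial_fact power_add)
  have "(\<lambda>i. r ^ j / fact j * ((- r) ^ i /\<^sub>R fact i)) sums (r ^ j / fact j * exp (- r))"
    by (intro sums_mult exp_converges)
  then have "(\<lambda>m. \<Sum>i\<le>m. r ^ j / fact j * ((- r) ^ i /\<^sub>R fact i)) \<longlonglongrightarrow> r ^ j / fact j * exp (- r)"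
    by (simp add: sums_def_le)
  also have "(\<lambda>m. \<Sum>i\<le>m. r ^ j / fact j * ((- r) ^ i /\<^sub>R fact i)) = T"
    unfolding T_def mult.assoc fc
    by (intro ext sum.cong refl) (simp add: power_minus[of r] divide_inverse mult_ac)
  also have "r ^ j / fact j * exp (- r) = pmf (poisson_pmf r) j"
    using r by simp
  finally have Tlim: "T \<longlonglongrightarrow> pmf (poisson_pmf r) j" .
  have "(\<lambda>m. r ^ j / fact j * (r ^ Suc m / fact (Suc m))) \<longlonglongrightarrow> r ^ j / fact j * 0"
    by (intro tendsto_mult tendsto_const filterlim_compose[OF _ filterlim_Suc, of "\<lambda>m. r ^ m / fact m"])
       (use summable_LIMSEQ_zero[OF summable_exp[of r]] in \<open>simp add: divide_inverse mult.commute\<close>)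
  then have Elim: "E \<longlonglongrightarrow> 0" unfolding E_def fc by simp
  show ?thesis
  proof (rule LIMSEQ_I)
    fix e :: real assume e: "e > 0"
    \<comment> \<open>The truncation level \<open>m\<close> is fixed before \<open>n\<close> grows,
      because the moments converge only for each fixed order.\<close>
    obtain m where m: "\<bar>T m - pmf (poisson_pmf r) j\<bar> < e / 4" "\<bar>E m\<bar> < e / 4"
    proof -
      have "\<forall>\<^sub>F m in sequentially. \<bar>T m - pmf (poisson_pmf r) j\<bar> < e / 4 \<and> \<bar>E m\<bar> < e / 4"
        using tendstoD[OF Tlim, of "e / 4"] tendstoD[OF Elim, of "e / 4"] e
        by (auto simp: dist_real_def elim: eventually_elim2)
      then show ?thesis using that by (auto simp: eventually_sequentially)
    qed
    let ?B = "\<lambda>n. \<Sum>i\<le>m. (-1) ^ i * real ((j + i) choose j) * M n (j + i)"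
    let ?D = "\<lambda>n. real ((j + Suc m) choose j) * M n (j + Suc m)"
    have "\<forall>\<^sub>F n in sequentially. dist (?B n) (T m) < e / 4" "\<forall>\<^sub>F n in sequentially. dist (?D n) (E m) < e / 4"
      using tendstoD[OF lim1[of m], of "e / 4"] tendstoD[OF lim2[of m], of "e / 4"] e by auto
    then have "\<forall>\<^sub>F n in sequentially. norm (pmf (p n) j - pmf (poisson_pmf r) j) < e"
    proof eventually_elim
      case (elim n)
      then show ?case
        using bon[of n m] m unfolding dist_real_def real_norm_def by linarith
    qed
    then show "\<exists>n0. \<forall>n\<ge>n0. norm (pmf (p n) j - pmf (poisson_pmf r) j) < e"
      by (simp add: eventually_sequentially)
  qed
qed

section \<open>Independent moves dominate tracked cards\<close>

text \<open>The right side expands into nonnegative terms indexed by the subsets where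
  \<open>b\<close> is chosen; the left side keeps the subsets with at most one element.\<close>

lemma prod_add_ge_first_order:
  fixes a b :: "'a \<Rightarrow> real"
  assumes "finite S" "\<And>l. l \<in> S \<Longrightarrow> 0 \<le> a l" "\<And>l. l \<in> S \<Longrightarrow> 0 \<le> b l"
  shows "(\<Prod>l\<in>S. a l) + (\<Sum>l\<in>S. b l * (\<Prod>m\<in>S - {l}. a m)) \<le> (\<Prod>l\<in>S. a l + b l)"
  using assms
proof (induction S)
  case empty then show ?case by simp
next
  case (insert x S)
  have ge: "(\<Prod>l\<in>S. a l) \<le> (\<Prod>l\<in>S. a l + b l)"
    using insert.prems by (intro prod_mono) auto
  have IH: "(\<Prod>l\<in>S. a l) + (\<Sum>l\<in>S. b l * (\<Prod>m\<in>S - {l}. a m)) \<le> (\<Prod>l\<in>S. a l + b l)"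
    using insert by auto
  have *: "(\<Prod>m\<in>insert x S - {l}. a m) = a x * (\<Prod>m\<in>S - {l}. a m)" if "l \<in> S" for l
  proof -
    have "insert x S - {l} = insert x (S - {l})" using that insert.hyps by auto
    then show ?thesis using insert.hyps by simp
  qed
  have "(\<Sum>l\<in>S. b l * (\<Prod>m\<in>insert x S - {l}. a m)) = a x * (\<Sum>l\<in>S. b l * (\<Prod>m\<in>S - {l}. a m))"
    unfolding sum_distrib_left by (intro sum.cong) (auto simp: *)
  then have "(\<Prod>l\<in>insert x S. a l) + (\<Sum>l\<in>insert x S. b l * (\<Prod>m\<in>insert x S - {l}. a m))
    = a x * ((\<Prod>l\<in>S. a l) + (\<Sum>l\<in>S. b l * (\<Prod>m\<in>S - {l}. a m))) + b x * (\<Prod>l\<in>S. a l)"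
    using insert.hyps by (simp add: algebra_simps)
  also have "\<dots> \<le> a x * (\<Prod>l\<in>S. a l + b l) + b x * (\<Prod>l\<in>S. a l + b l)"
    using insert.prems ge IH by (intro add_mono mult_left_mono) auto
  finally show ?case using insert.hyps by (simp add: algebra_simps)
qed

text \<open>\<open>y\<close> gives the positions of the tracked cards. The three terms collect the
  steps in which no draw, exactly one draw or both draws hit a tracked position; the factor 2 counts
  the order of the draws, and \<open>l = m\<close> in the last sum is one position drawn
  twice.\<close>

lemma sum_transpositions_split:
  fixes p :: "'a \<Rightarrow> real" and h :: "('a \<Rightarrow> 'a) \<Rightarrow> real"
  assumes fin: "finite U" "finite S" and y: "inj_on y S" "y ` S \<subseteq> U" and p1: "sum p U = 1"
    and h: "\<And>z z'. (\<And>i. i \<in> S \<Longrightarrow> z i = z' i) \<Longrightarrow> h z = h z'"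
  shows "(\<Sum>i\<in>U. \<Sum>j\<in>U. p i * p j * h (Transposition.transpose i j \<circ> y)) =
     (1 - (\<Sum>l\<in>S. p (y l)))\<^sup>2 * h y
     + 2 * (\<Sum>l\<in>S. p (y l) * (\<Sum>j\<in>U - y ` S. p j * h (y(l := j))))
     + (\<Sum>l\<in>S. \<Sum>m\<in>S. p (y l) * p (y m) * h (y \<circ> Transposition.transpose l m))"
proof -
  let ?V = "U - y ` S"
  let ?f = "\<lambda>i j. p i * p j * h (Transposition.transpose i j \<circ> y)"
  have split: "(\<Sum>i\<in>U. g i) = (\<Sum>i\<in>?V. g i) + (\<Sum>l\<in>S. g (y l))" for g :: "'a \<Rightarrow> real"
    using sum.subset_diff[of "y ` S" U g] y fin by (simp add: sum.reindex)
  have sV: "sum p ?V = 1 - (\<Sum>l\<in>S. p (y l))" using split[of p] p1 by simp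
  have comm: "?f i j = ?f j i" for i j by (simp add: transpose_commute)
  have "(\<Sum>i\<in>U. \<Sum>j\<in>U. ?f i j) = (\<Sum>i\<in>?V. \<Sum>j\<in>?V. ?f i j) + (\<Sum>i\<in>?V. \<Sum>l\<in>S. ?f i (y l))
    + (\<Sum>l\<in>S. \<Sum>j\<in>?V. ?f (y l) j) + (\<Sum>l\<in>S. \<Sum>m\<in>S. ?f (y l) (y m))"
    by (simp add: split sum.distrib)
  also have "(\<Sum>i\<in>?V. \<Sum>l\<in>S. ?f i (y l)) = (\<Sum>l\<in>S. \<Sum>j\<in>?V. ?f (y l) j)"
    by (subst sum.swap) (simp add: comm)
  also have "(\<Sum>i\<in>?V. \<Sum>j\<in>?V. ?f i j) = (\<Sum>i\<in>?V. \<Sum>j\<in>?V. p i * p j * h y)"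
    by (intro sum.cong refl arg_cong2[where f="(*)"] h) (auto simp: Transposition.transpose_def)
  also have "\<dots> = (1 - (\<Sum>l\<in>S. p (y l)))\<^sup>2 * h y"
    by (simp add: power2_eq_square sum_product flip: sV) (simp add: sum_distrib_right)
  also have "(\<Sum>l\<in>S. \<Sum>j\<in>?V. ?f (y l) j) = (\<Sum>l\<in>S. p (y l) * (\<Sum>j\<in>?V. p j * h (y(l := j))))"
  proof (intro sum.cong refl)
    fix l assume l: "l \<in> S"
    have "h (Transposition.transpose (y l) j \<circ> y) = h (y(l := j))" if "j \<in> ?V" for j
      using that l y(1) by (intro h) (auto simp: Transposition.transpose_def inj_on_def)
    then show "(\<Sum>j\<in>?V. ?f (y l) j) = p (y l) * (\<Sum>j\<in>?V. p j * h (y(l := j)))"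
      unfolding sum_distrib_left by (intro sum.cong) auto
  qed
  also have "(\<Sum>l\<in>S. \<Sum>m\<in>S. ?f (y l) (y m)) =
      (\<Sum>l\<in>S. \<Sum>m\<in>S. p (y l) * p (y m) * h (y \<circ> Transposition.transpose l m))"
    using y(1) by (intro sum.cong refl arg_cong2[where f="(*)"] h) (auto simp: Transposition.transpose_def inj_on_def)
  finally show ?thesis by linarith
qed

text \<open>Up to the factor \<open>1 + 2 s\<^sup>2\<close>, a step that moves at most one tracked card is dominated by
  letting all tracked cards jump independently; \<open>g\<close> compensates the missing holding
  probabilities of the other cards.\<close>

lemma single_moves_le_prod:
  fixes p :: "'a \<Rightarrow> real" and u v :: "'b \<Rightarrow> 'a \<Rightarrow> real"
  defines "s \<equiv> \<lambda>(S :: 'b set) y. \<Sum>l\<in>S. p (y l)"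
  assumes fin: "finite U" "finite S" and y: "y ` S \<subseteq> U"
    and p: "\<And>i. i \<in> U \<Longrightarrow> 0 \<le> p i" and s: "4 * s S y \<le> 1"
    and u: "\<And>l z. l \<in> S \<Longrightarrow> z \<in> U \<Longrightarrow> 0 \<le> u l z"
    and g: "0 \<le> g" "1 \<le> (1 + g) * (1 - 2 * s S y)"
    and v: "\<And>l z. l \<in> S \<Longrightarrow> z \<in> U \<Longrightarrow>
       (1 - 2 * p z) * u l z + 2 * (1 + g) * p z * (\<Sum>w\<in>U. p w * u l w) \<le> v l z"
  shows "(1 - s S y)\<^sup>2 * (\<Prod>l\<in>S. u l (y l))
     + 2 * (\<Sum>l\<in>S. p (y l) * (\<Sum>j\<in>U - y ` S. p j * (\<Prod>m\<in>S. u m ((y(l := j)) m))))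
     \<le> (1 + 2 * (s S y)\<^sup>2) * (\<Prod>l\<in>S. v l (y l))"
proof -
  let ?s = "s S y"
  define D where "D l = (1 - 2 * p (y l)) * u l (y l)" for l
  define J where "J l = 2 * p (y l) * (\<Sum>w\<in>U. p w * u l w)" for l
  define Q where "Q l = (\<Prod>m\<in>S - {l}. u m (y m))" for l
  have yU: "y l \<in> U" if "l \<in> S" for l using that y by auto
  have pl: "p (y l) \<le> ?s" if "l \<in> S" for l
    unfolding s_def using that fin p yU by (intro member_le_sum) auto
  have s0: "0 \<le> ?s" unfolding s_def using p yU by (intro sum_nonneg) auto
  have half: "2 * p (y l) \<le> 1/2" if "l \<in> S" for l using pl[OF that] s by simp
  have D0: "0 \<le> D l" if "l \<in> S" for l
    unfolding D_def using that half[OF that] u yU by (intro mult_nonneg_nonneg) auto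
  have J0: "0 \<le> J l" if "l \<in> S" for l
    unfolding J_def using that p u yU by (intro mult_nonneg_nonneg sum_nonneg) auto
  have Q0: "0 \<le> Q l" for l unfolding Q_def using u yU by (intro prod_nonneg) auto
  \<comment> \<open>Weierstrass' product inequality for the holding factors, stated for subsets
    because it is needed for \<open>S\<close> and for each \<open>S - {l}\<close>.\<close>
  have prodD: "(1 - 2 * ?s) * (\<Prod>m\<in>T. u m (y m)) \<le> (\<Prod>m\<in>T. D m)" if T: "T \<subseteq> S" for T
  proof -
    have "1 - 2 * ?s \<le> 1 - (\<Sum>m\<in>T. 2 * p (y m))"
      unfolding s_def using T fin p yU by (auto simp: sum_distrib_left intro!: sum_mono2)
    also have "\<dots> \<le> (\<Prod>m\<in>T. 1 - 2 * p (y m))"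
    proof (rule Weierstrass_prod_ineq)
      fix m assume "m \<in> T"
      then have "m \<in> S" using T by auto
      then show "2 * p (y m) \<in> {0..1}" using half[of m] p yU[of m] by auto
    qed
    finally have "(1 - 2 * ?s) * (\<Prod>m\<in>T. u m (y m)) \<le> (\<Prod>m\<in>T. 1 - 2 * p (y m)) * (\<Prod>m\<in>T. u m (y m))"
      using T u yU by (intro mult_right_mono prod_nonneg) auto
    then show ?thesis by (simp add: D_def prod.distrib)
  qed
  have "(1 - 2 * ?s) * (\<Prod>m\<in>S. u m (y m)) + (\<Sum>l\<in>S. J l * Q l)
      \<le> (\<Prod>l\<in>S. D l) + (\<Sum>l\<in>S. ((1 + g) * J l) * (\<Prod>m\<in>S - {l}. D m))"
  proof (intro add_mono prodD sum_mono)
    fix l assume l: "l \<in> S"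
    have "J l * Q l \<le> J l * (((1 + g) * (1 - 2 * ?s)) * Q l)"
      using g(2) Q0[of l] J0[OF l] by (intro mult_left_mono) (auto simp: mult_le_cancel_right1)
    also have "\<dots> = ((1 + g) * J l) * ((1 - 2 * ?s) * Q l)" by simp
    also have "\<dots> \<le> ((1 + g) * J l) * (\<Prod>m\<in>S - {l}. D m)"
      unfolding Q_def using g(1) J0[OF l] by (intro mult_left_mono prodD) auto
    finally show "J l * Q l \<le> ((1 + g) * J l) * (\<Prod>m\<in>S - {l}. D m)" .
  qed auto
  also have "\<dots> \<le> (\<Prod>l\<in>S. D l + (1 + g) * J l)"
    using D0 J0 g(1) fin by (intro prod_add_ge_first_order) auto
  also have "\<dots> \<le> (\<Prod>l\<in>S. v l (y l))"
  proof (intro prod_mono conjI)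
    fix l assume l: "l \<in> S"
    show "0 \<le> D l + (1 + g) * J l" using D0 J0 g l by auto
    show "D l + (1 + g) * J l \<le> v l (y l)"
      using v[OF l yU[OF l]] unfolding D_def J_def by (simp add: algebra_simps)
  qed
  finally have main: "(1 - 2 * ?s) * (\<Prod>m\<in>S. u m (y m)) + (\<Sum>l\<in>S. J l * Q l) \<le> (\<Prod>l\<in>S. v l (y l))" .
  \<comment> \<open>The excess \<open>?s\<^sup>2\<close> of the true holding probability over
    \<open>1 - 2 * ?s\<close> is absorbed by the factor \<open>1 + 2 * ?s\<^sup>2\<close>; this uses
    \<open>4 * ?s \<le> 1\<close>.\<close>
  have sq: "(1 - ?s)\<^sup>2 \<le> (1 + 2 * ?s\<^sup>2) * (1 - 2 * ?s)"
  proof -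
    have "(1 + 2 * ?s\<^sup>2) * (1 - 2 * ?s) - (1 - ?s)\<^sup>2 = ?s\<^sup>2 * (1 - 4 * ?s)"
      by (simp add: power2_eq_square algebra_simps)
    moreover have "0 \<le> ?s\<^sup>2 * (1 - 4 * ?s)" using s by simp
    ultimately show ?thesis by linarith
  qed
  \<comment> \<open>Letting the card \<open>l\<close> land on tracked positions as well only adds
    nonnegative terms and produces the full sum in \<open>J l\<close>.\<close>
  have single: "2 * (\<Sum>l\<in>S. p (y l) * (\<Sum>j\<in>U - y ` S. p j * (\<Prod>m\<in>S. u m ((y(l := j)) m)))) \<le> (\<Sum>l\<in>S. J l * Q l)"
    unfolding sum_distrib_left[of 2]
  proof (rule sum_mono)
    fix l assume l: "l \<in> S"
    have e: "(\<Prod>m\<in>S. u m ((y(l := j)) m)) = u l j * Q l" for j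
      unfolding Q_def using l fin by (subst prod.remove[of S l]) auto
    have "2 * (p (y l) * (\<Sum>j\<in>U - y ` S. p j * (\<Prod>m\<in>S. u m ((y(l := j)) m))))
      = 2 * (p (y l) * (\<Sum>j\<in>U - y ` S. p j * u l j)) * Q l"
      unfolding e by (simp add: sum_distrib_left sum_distrib_right mult_ac)
    also have "\<dots> \<le> 2 * (p (y l) * (\<Sum>j\<in>U. p j * u l j)) * Q l"
      using Q0[of l] p u l yU fin
      by (intro mult_right_mono mult_left_mono sum_mono2) auto
    finally show "2 * (p (y l) * (\<Sum>j\<in>U - y ` S. p j * (\<Prod>m\<in>S. u m ((y(l := j)) m)))) \<le> J l * Q l"
      by (simp add: J_def mult_ac)
  qed
  have u0: "0 \<le> (\<Prod>l\<in>S. u l (y l))" using u yU by (intro prod_nonneg) auto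
  have "(1 - ?s)\<^sup>2 * (\<Prod>l\<in>S. u l (y l)) + (\<Sum>l\<in>S. J l * Q l)
     \<le> (1 + 2 * ?s\<^sup>2) * ((1 - 2 * ?s) * (\<Prod>l\<in>S. u l (y l))) + (1 + 2 * ?s\<^sup>2) * (\<Sum>l\<in>S. J l * Q l)"
  proof (rule add_mono)
    show "(1 - ?s)\<^sup>2 * (\<Prod>l\<in>S. u l (y l)) \<le> (1 + 2 * ?s\<^sup>2) * ((1 - 2 * ?s) * (\<Prod>l\<in>S. u l (y l)))"
      using mult_right_mono[OF sq u0] by (simp add: mult.assoc)
    have "0 \<le> (\<Sum>l\<in>S. J l * Q l)" using J0 Q0 by (intro sum_nonneg) auto
    then show "(\<Sum>l\<in>S. J l * Q l) \<le> (1 + 2 * ?s\<^sup>2) * (\<Sum>l\<in>S. J l * Q l)"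
      by (simp add: mult_le_cancel_right1)
  qed
  also have "\<dots> \<le> (1 + 2 * ?s\<^sup>2) * (\<Prod>l\<in>S. v l (y l))"
    unfolding distrib_left[symmetric] using main by (intro mult_left_mono) auto
  finally show ?thesis using single by linarith
qed

text \<open>This is the permanent of the matrix \<open>u l (y m)\<close> over \<open>l\<close>,
  \<open>m\<close> in \<open>S\<close>. It is invariant under rearranging the targets, so exchanges
  among tracked cards leave it unchanged.\<close>

definition perm_majorant :: "('a \<Rightarrow> 'a \<Rightarrow> real) \<Rightarrow> 'a set \<Rightarrow> ('a \<Rightarrow> 'a) \<Rightarrow> real" where
  "perm_majorant u S y = (\<Sum>\<pi> | \<pi> permutes S. \<Prod>l\<in>S. u l (y (\<pi> l)))"

lemma perm_majorant_comp:
  assumes "\<tau> permutes S"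
  shows "perm_majorant u S (y \<circ> \<tau>) = perm_majorant u S y"
  unfolding perm_majorant_def
  using setum_permutations_compose_left[OF assms, of "\<lambda>\<pi>. \<Prod>l\<in>S. u l (y (\<pi> l))"] by simp

lemma prod_le_perm_majorant:
  assumes "finite S" "\<pi> permutes S" "\<And>l m. l \<in> S \<Longrightarrow> m \<in> S \<Longrightarrow> 0 \<le> u l (y m)"
  shows "(\<Prod>l\<in>S. u l (y (\<pi> l))) \<le> perm_majorant u S y"
  unfolding perm_majorant_def
proof (rule member_le_sum[of \<pi> _ "\<lambda>\<pi>. \<Prod>l\<in>S. u l (y (\<pi> l))"])
  show "finite {\<pi>. \<pi> permutes S}" using assms by (simp add: finite_permutations)
qed (use assms in \<open>auto intro!: prod_nonneg simp: permutes_in_image\<close>)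

text \<open>One step of the shuffle acts on the pair (product, sum over permutations); the latter absorbs
  the direct exchanges of two tracked cards, which the independent chain cannot imitate.\<close>

lemma step_majorant:
  fixes p :: "'a \<Rightarrow> real" and u v :: "'a \<Rightarrow> 'a \<Rightarrow> real"
  defines "s \<equiv> \<lambda>(S :: 'a set) y. \<Sum>l\<in>S. p (y l)"
  assumes fin: "finite U" "finite S" and y: "inj_on y S" "y ` S \<subseteq> U" and p1: "sum p U = 1"
    and p: "\<And>i. i \<in> U \<Longrightarrow> 0 \<le> p i" and s: "4 * s S y \<le> 1"
    and u: "\<And>l z. l \<in> S \<Longrightarrow> z \<in> U \<Longrightarrow> 0 \<le> u l z"
    and uv: "\<And>l z. l \<in> S \<Longrightarrow> z \<in> U \<Longrightarrow> u l z \<le> 2 * v l z"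
    and g: "0 \<le> g" "1 \<le> (1 + g) * (1 - 2 * s S y)"
    and v: "\<And>l z. l \<in> S \<Longrightarrow> z \<in> U \<Longrightarrow>
       (1 - 2 * p z) * u l z + 2 * (1 + g) * p z * (\<Sum>w\<in>U. p w * u l w) \<le> v l z"
    and K: "(s S y)\<^sup>2 * (2 + 2 ^ card S) \<le> K" and b: "0 \<le> b"
  shows "(\<Sum>i\<in>U. \<Sum>j\<in>U. p i * p j * ((\<Prod>l\<in>S. u l ((Transposition.transpose i j \<circ> y) l))
        + b * perm_majorant u S (Transposition.transpose i j \<circ> y)))
     \<le> (\<Prod>l\<in>S. v l (y l)) + ((1 + b) * (1 + K) - 1) * perm_majorant v S y"
proof -
  let ?s = "s S y"
  let ?T = "\<lambda>h. \<Sum>i\<in>U. \<Sum>j\<in>U. p i * p j * h (Transposition.transpose i j \<circ> y)"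
  let ?P = "perm_majorant v S y"
  have yU: "y l \<in> U" if "l \<in> S" for l using that y by auto
  have v0: "0 \<le> v l z" if "l \<in> S" "z \<in> U" for l z using u[OF that] uv[OF that] by linarith
  have P0: "0 \<le> ?P" unfolding perm_majorant_def using v0 yU
    by (intro sum_nonneg prod_nonneg) (auto simp: permutes_in_image)
  \<comment> \<open>Each of the \<open>card S\<close> factors of a product loses at most a factor
    2.\<close>
  have uP: "perm_majorant u S y \<le> 2 ^ card S * ?P"
    unfolding perm_majorant_def sum_distrib_left
  proof (rule sum_mono)
    fix \<pi> assume "\<pi> \<in> {\<pi>. \<pi> permutes S}"
    then have pi: "y (\<pi> l) \<in> U" if "l \<in> S" for l using yU that by (auto simp: permutes_in_image)
    have "(\<Prod>l\<in>S. u l (y (\<pi> l))) \<le> (\<Prod>l\<in>S. 2 * v l (y (\<pi> l)))"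
      using u uv pi by (intro prod_mono) auto
    then show "(\<Prod>l\<in>S. u l (y (\<pi> l))) \<le> 2 ^ card S * (\<Prod>l\<in>S. v l (y (\<pi> l)))"
      by (simp add: prod.distrib)
  qed
  have s0: "0 \<le> ?s" unfolding s_def using p yU by (intro sum_nonneg) auto
  have cong: "(\<Prod>l\<in>S. u l (z (\<pi> l))) = (\<Prod>l\<in>S. u l (z' (\<pi> l)))"
    if "\<pi> permutes S" "\<And>i. i \<in> S \<Longrightarrow> z i = z' i" for z z' \<pi>
    using that by (intro prod.cong) (auto simp: permutes_in_image)
  have swap: "(\<Sum>l\<in>S. \<Sum>m\<in>S. p (y l) * p (y m) * h (y \<circ> Transposition.transpose l m)) \<le> ?s\<^sup>2 * C"
    if "\<And>\<tau>. \<tau> permutes S \<Longrightarrow> h (y \<circ> \<tau>) \<le> C" for h :: "('a \<Rightarrow> 'a) \<Rightarrow> real" and C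
  proof -
    have "(\<Sum>l\<in>S. \<Sum>m\<in>S. p (y l) * p (y m) * h (y \<circ> Transposition.transpose l m))
      \<le> (\<Sum>l\<in>S. \<Sum>m\<in>S. p (y l) * p (y m) * C)"
      using p yU by (intro sum_mono mult_left_mono that permutes_swap_id mult_nonneg_nonneg) auto
    also have "\<dots> = ?s\<^sup>2 * C"
      unfolding s_def power2_eq_square by (subst sum_product) (simp only: sum_distrib_right)
    finally show ?thesis .
  qed
  \<comment> \<open>Reindexing by \<open>inv \<pi>\<close> turns a summand of the permanent into a
    product with permuted rows, to which \<open>single_moves_le_prod\<close> applies.\<close>
  have term_le: "(1 - ?s)\<^sup>2 * (\<Prod>l\<in>S. u l (y (\<pi> l)))
     + 2 * (\<Sum>l\<in>S. p (y l) * (\<Sum>j\<in>U - y ` S. p j * (\<Prod>m\<in>S. u m ((y(l := j)) (\<pi> m)))))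
     \<le> (1 + 2 * ?s\<^sup>2) * (\<Prod>l\<in>S. v l (y (\<pi> l)))" if pi: "\<pi> permutes S" for \<pi>
  proof -
    have re: "(\<Prod>l\<in>S. f l (z (\<pi> l))) = (\<Prod>l\<in>S. f (inv \<pi> l) (z l))" for f :: "'a \<Rightarrow> 'a \<Rightarrow> real" and z
      using prod.permute[OF pi, of "\<lambda>l. f (inv \<pi> l) (z l)"] permutes_inverses[OF pi]
      by (simp add: comp_def)
    have inS: "inv \<pi> l \<in> S" if "l \<in> S" for l
      using permutes_in_image[OF permutes_inv[OF pi]] that by simp
    show ?thesis unfolding re s_def
      by (rule single_moves_le_prod[where g = g])
         (use fin y p s u g v inS in \<open>auto simp: s_def\<close>)
  qed
  have T1: "?T (\<lambda>z. \<Prod>l\<in>S. u l (z l)) \<le> (1 + 2 * ?s\<^sup>2) * (\<Prod>l\<in>S. v l (y l)) + ?s\<^sup>2 * (2 ^ card S * ?P)"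
  proof -
    have "?T (\<lambda>z. \<Prod>l\<in>S. u l (z l)) = (1 - ?s)\<^sup>2 * (\<Prod>l\<in>S. u l (y l))
     + 2 * (\<Sum>l\<in>S. p (y l) * (\<Sum>j\<in>U - y ` S. p j * (\<Prod>m\<in>S. u m ((y(l := j)) m))))
     + (\<Sum>l\<in>S. \<Sum>m\<in>S. p (y l) * p (y m) * (\<Prod>k\<in>S. u k ((y \<circ> Transposition.transpose l m) k)))"
      unfolding s_def
      by (rule sum_transpositions_split[OF fin y p1, of "\<lambda>z. \<Prod>l\<in>S. u l (z l)"]) (rule prod.cong, auto)
    also have "(\<Sum>l\<in>S. \<Sum>m\<in>S. p (y l) * p (y m) * (\<Prod>k\<in>S. u k ((y \<circ> Transposition.transpose l m) k)))
      \<le> ?s\<^sup>2 * (2 ^ card S * ?P)"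
    proof (rule swap)
      fix \<tau> assume t: "\<tau> permutes S"
      have "(\<Prod>k\<in>S. u k ((y \<circ> \<tau>) k)) \<le> perm_majorant u S y"
        using prod_le_perm_majorant[OF fin(2) t, of u y] u yU by simp
      then show "(\<Prod>k\<in>S. u k ((y \<circ> \<tau>) k)) \<le> 2 ^ card S * ?P" using uP by linarith
    qed
    also have "(1 - ?s)\<^sup>2 * (\<Prod>l\<in>S. u l (y l))
     + 2 * (\<Sum>l\<in>S. p (y l) * (\<Sum>j\<in>U - y ` S. p j * (\<Prod>m\<in>S. u m ((y(l := j)) m))))
      \<le> (1 + 2 * ?s\<^sup>2) * (\<Prod>l\<in>S. v l (y l))"
      using term_le[OF permutes_id] by simp
    finally show ?thesis by simp
  qed
  have T2: "?T (perm_majorant u S) \<le> (1 + 2 * ?s\<^sup>2) * ?P + ?s\<^sup>2 * (2 ^ card S * ?P)"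
  proof -
    have "?T (perm_majorant u S) = (1 - ?s)\<^sup>2 * perm_majorant u S y
     + 2 * (\<Sum>l\<in>S. p (y l) * (\<Sum>j\<in>U - y ` S. p j * perm_majorant u S (y(l := j))))
     + (\<Sum>l\<in>S. \<Sum>m\<in>S. p (y l) * p (y m) * perm_majorant u S (y \<circ> Transposition.transpose l m))"
      unfolding s_def
      by (rule sum_transpositions_split[OF fin y p1]) (unfold perm_majorant_def, intro sum.cong cong, auto)
    also have "(\<Sum>l\<in>S. \<Sum>m\<in>S. p (y l) * p (y m) * perm_majorant u S (y \<circ> Transposition.transpose l m))
      \<le> ?s\<^sup>2 * (2 ^ card S * ?P)"
      using uP by (intro swap) (simp only: perm_majorant_comp)
    also have "(1 - ?s)\<^sup>2 * perm_majorant u S y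
        + 2 * (\<Sum>l\<in>S. p (y l) * (\<Sum>j\<in>U - y ` S. p j * perm_majorant u S (y(l := j))))
      = (\<Sum>\<pi> | \<pi> permutes S. (1 - ?s)\<^sup>2 * (\<Prod>l\<in>S. u l (y (\<pi> l)))
     + 2 * (\<Sum>l\<in>S. p (y l) * (\<Sum>j\<in>U - y ` S. p j * (\<Prod>m\<in>S. u m ((y(l := j)) (\<pi> m))))))"
      unfolding perm_majorant_def sum.distrib sum_distrib_left
      by (rule arg_cong2[where f = "(+)", OF refl trans[OF sum.cong[OF refl sum.swap] sum.swap]])
    also have "\<dots> \<le> (\<Sum>\<pi> | \<pi> permutes S. (1 + 2 * ?s\<^sup>2) * (\<Prod>l\<in>S. v l (y (\<pi> l))))"
      by (intro sum_mono term_le) simp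
    also have "\<dots> = (1 + 2 * ?s\<^sup>2) * ?P" by (simp add: perm_majorant_def sum_distrib_left)
    finally show ?thesis by linarith
  qed
  \<comment> \<open>This moves the excess \<open>2 * ?s\<^sup>2\<close> of the product term into the
    permanent, so that the product keeps the coefficient 1.\<close>
  have idle: "(\<Prod>l\<in>S. v l (y l)) \<le> ?P"
    using prod_le_perm_majorant[OF fin(2) permutes_id, of v y] v0 yU by simp
  have "(\<Sum>i\<in>U. \<Sum>j\<in>U. p i * p j * ((\<Prod>l\<in>S. u l ((Transposition.transpose i j \<circ> y) l))
        + b * perm_majorant u S (Transposition.transpose i j \<circ> y)))
      = ?T (\<lambda>z. \<Prod>l\<in>S. u l (z l)) + b * ?T (perm_majorant u S)"
    by (simp add: distrib_left sum.distrib sum_distrib_left mult_ac)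
  also have "\<dots> \<le> ((1 + 2 * ?s\<^sup>2) * (\<Prod>l\<in>S. v l (y l)) + ?s\<^sup>2 * (2 ^ card S * ?P))
      + b * ((1 + 2 * ?s\<^sup>2) * ?P + ?s\<^sup>2 * (2 ^ card S * ?P))"
    using b by (intro add_mono mult_left_mono T1 T2)
  also have "\<dots> \<le> (\<Prod>l\<in>S. v l (y l)) + (?s\<^sup>2 * (2 + 2 ^ card S)) * ?P + b * ?P + b * ((?s\<^sup>2 * (2 + 2 ^ card S)) * ?P)"
    using mult_left_mono[OF idle, of "2 * ?s\<^sup>2"] by (simp add: algebra_simps)
  also have "\<dots> \<le> (\<Prod>l\<in>S. v l (y l)) + K * ?P + b * ?P + b * (K * ?P)"
    using b by (intro add_mono mult_left_mono mult_right_mono K P0) auto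
  also have "\<dots> = (\<Prod>l\<in>S. v l (y l)) + ((1 + b) * (1 + K) - 1) * ?P"
    by (simp add: algebra_simps)
  finally show ?thesis .
qed

section \<open>The biased deck and the one-card chain\<close>

lemma measure_bind_pmf:
  "measure_pmf.prob (bind_pmf M f) X = measure_pmf.expectation M (\<lambda>x. measure_pmf.prob (f x) X)"
  unfolding measure_pmf_bind
  using measurable_measure_pmf[of f]
  by (intro measure_pmf.measure_bind[where N = "count_space UNIV"]) (simp_all add: measurable_def)

locale biased_deck =
  fixes a b :: real and n :: nat and A B :: "nat set"
  assumes b_pos: "0 < b" and b_le_a: "b \<le> a" and ab: "a + b = 2"
    and AB: "A \<union> B = {1..2 * n}" "A \<inter> B = {}" and card_AB: "card A = n" "card B = n"
    and n_pos: "0 < n"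
begin

abbreviation "U \<equiv> {1..2 * n}"
abbreviation "law \<equiv> shuffle a b (2 * n) A B"

definition p :: "nat \<Rightarrow> real" where
  "p x = (if x \<in> A then a / real (2 * n) else if x \<in> B then b / real (2 * n) else 0)"

lemma pmf_card: "pmf (biased_card a b (2 * n) A B) x = p x"
  unfolding p_def using b_pos b_le_a ab AB card_AB n_pos by (intro pmf_biased_card) auto

lemma a_less_2: "a < 2" and b_le_1: "b \<le> 1" and ab_le_1: "a * b \<le> 1"
  and a_pos: "0 < a"
proof -
  show "a < 2" "b \<le> 1" "0 < a" using b_pos b_le_a ab by linarith+
  have "a * b = 1 - ((a - b) / 2)\<^sup>2"
    using arg_cong[OF ab, of "\<lambda>x. x\<^sup>2"] by (simp add: power2_eq_square field_simps)
  then show "a * b \<le> 1" by simp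
qed

lemma fin_AB: "finite A" "finite B"
  using AB by (metis finite_Un finite_atLeastAtMost)+

lemma p_nonneg: "0 \<le> p x"
  unfolding p_def using b_pos a_pos by auto

lemma p_le: "p x \<le> 1 / n"
  unfolding p_def using a_less_2 b_le_1 n_pos by (auto simp: field_simps)

lemma sum_split: "sum f U = sum f A + sum f B" for f :: "nat \<Rightarrow> real"
  unfolding AB(1)[symmetric] using fin_AB AB(2) by (rule sum.union_disjoint)

lemma sum_p: "sum p U = 1"
proof -
  have "sum p A = (\<Sum>x\<in>A. a / real (2 * n))" "sum p B = (\<Sum>x\<in>B. b / real (2 * n))"
    using AB(2) unfolding p_def by (intro sum.cong refl; auto)+
  then show ?thesis unfolding sum_split using card_AB n_pos ab by (simp add: field_simps)
qed

text \<open>The draws of a step do not depend on the current permutation, so they may be made first;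
  this isolates the last transposition.\<close>

lemma shuffle_Suc_commute:
  "law (Suc t) = bind_pmf (pair_pmf (biased_card a b (2 * n) A B) (biased_card a b (2 * n) A B))
     (\<lambda>(i, j). map_pmf (\<lambda>\<sigma>. Transposition.transpose i j \<circ> \<sigma>) (law t))"
proof -
  have "law (Suc t) = bind_pmf (law t) (\<lambda>\<sigma>. bind_pmf (pair_pmf (biased_card a b (2 * n) A B) (biased_card a b (2 * n) A B))
      (\<lambda>x. return_pmf ((case x of (i, j) \<Rightarrow> Transposition.transpose i j \<circ> \<sigma>))))"
    by (simp add: shuffle_step_def[abs_def] map_pmf_def)
  also have "\<dots> = bind_pmf (pair_pmf (biased_card a b (2 * n) A B) (biased_card a b (2 * n) A B))
      (\<lambda>x. bind_pmf (law t) (\<lambda>\<sigma>. return_pmf ((case x of (i, j) \<Rightarrow> Transposition.transpose i j \<circ> \<sigma>))))"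
    by (rule bind_commute_pmf)
  finally show ?thesis by (simp add: map_pmf_def split_def)
qed

lemma prob_shuffle_Suc:
  "measure_pmf.prob (law (Suc t)) E =
     (\<Sum>i\<in>U. \<Sum>j\<in>U. p i * p j * measure_pmf.prob (law t) {\<sigma>. Transposition.transpose i j \<circ> \<sigma> \<in> E})"
proof -
  let ?c = "biased_card a b (2 * n) A B"
  let ?f = "\<lambda>(i, j). measure_pmf.prob (law t) {\<sigma>. Transposition.transpose i j \<circ> \<sigma> \<in> E}"
  have supp: "set_pmf (pair_pmf ?c ?c) \<subseteq> U \<times> U"
  proof -
    have "x \<in> U" if "x \<in> set_pmf ?c" for x
      using that unfolding AB(1)[symmetric] set_pmf_iff pmf_card p_def by (auto split: if_splits)
    then show ?thesis by (auto simp only: set_pair_pmf)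
  qed
  have "measure_pmf.prob (law (Suc t)) E = measure_pmf.expectation (pair_pmf ?c ?c) ?f"
    unfolding shuffle_Suc_commute measure_bind_pmf
    by (intro Bochner_Integration.integral_cong refl) (simp add: vimage_def split_def)
  also have "\<dots> = (\<Sum>x\<in>U \<times> U. ?f x * pmf (pair_pmf ?c ?c) x)"
    by (rule integral_measure_pmf_real) (use supp in auto)
  also have "\<dots> = (\<Sum>i\<in>U. \<Sum>j\<in>U. p i * p j * measure_pmf.prob (law t) {\<sigma>. Transposition.transpose i j \<circ> \<sigma> \<in> E})"
    unfolding sum.cartesian_product by (intro sum.cong) (auto simp: pmf_pair pmf_card)
  finally show ?thesis .
qed

text \<open>Only the values of \<open>y\<close> on \<open>S\<close> matter, and
  \<open>y = id\<close> gives the return probability of the tracked cards. General targets are kept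
  because the recursion in \<open>t\<close> changes them.\<close>

definition move_prob :: "nat \<Rightarrow> nat set \<Rightarrow> (nat \<Rightarrow> nat) \<Rightarrow> real" where
  "move_prob t S y = measure_pmf.prob (law t) {\<sigma>. \<forall>i\<in>S. \<sigma> i = y i}"

lemma move_prob_0: "move_prob 0 S y = (if \<forall>i\<in>S. y i = i then 1 else 0)"
  unfolding move_prob_def by (auto simp: indicator_def) metis

text \<open>A transposition is its own inverse, so the last step can be undone on the target
  \<open>y\<close>.\<close>

lemma move_prob_Suc:
  "move_prob (Suc t) S y = (\<Sum>i\<in>U. \<Sum>j\<in>U. p i * p j * move_prob t S (Transposition.transpose i j \<circ> y))"
proof -
  have "{\<sigma>. Transposition.transpose i j \<circ> \<sigma> \<in> {\<sigma>. \<forall>l\<in>S. \<sigma> l = y l}} =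
      {\<sigma>. \<forall>l\<in>S. \<sigma> l = (Transposition.transpose i j \<circ> y) l}" for i j
  proof (intro Collect_cong, simp)
    fix \<sigma> :: "nat \<Rightarrow> nat"
    show "(\<forall>l\<in>S. Transposition.transpose i j (\<sigma> l) = y l) = (\<forall>l\<in>S. \<sigma> l = Transposition.transpose i j (y l))"
      by (intro ball_cong refl) (metis transpose_involutory)
  qed
  then show ?thesis unfolding move_prob_def prob_shuffle_Suc by simp
qed

lemma move_prob_nonneg: "0 \<le> move_prob t S y" by (simp add: move_prob_def)

text \<open>Only the steps whose two draws both avoid \<open>S\<close> are kept.\<close>

lemma move_prob_id_Suc_ge:
  assumes "S \<subseteq> U"
  shows "(1 - sum p S)\<^sup>2 * move_prob t S id \<le> move_prob (Suc t) S id"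
proof -
  have fin: "finite S" using assms finite_subset by blast
  have sV: "sum p (U - S) = 1 - sum p S"
    using sum_diff[of U S p] assms sum_p by simp
  have "(1 - sum p S)\<^sup>2 * move_prob t S id = (\<Sum>i\<in>U - S. \<Sum>j\<in>U - S. p i * p j * move_prob t S id)"
    unfolding sV[symmetric] power2_eq_square by (subst sum_product) (simp only: sum_distrib_right)
  also have "\<dots> = (\<Sum>i\<in>U - S. \<Sum>j\<in>U - S. p i * p j * move_prob t S (Transposition.transpose i j \<circ> id))"
  proof (intro sum.cong refl arg_cong2[where f = "(*)"])
    fix i j assume "i \<in> U - S" "j \<in> U - S"
    then have "\<forall>l\<in>S. (Transposition.transpose i j \<circ> id) l = id l"
      by (auto simp: Transposition.transpose_def)
    then show "move_prob t S id = move_prob t S (Transposition.transpose i j \<circ> id)"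
      unfolding move_prob_def by (intro arg_cong2[where f = measure] refl Collect_cong) simp
  qed
  also have "\<dots> \<le> (\<Sum>i\<in>U. \<Sum>j\<in>U - S. p i * p j * move_prob t S (Transposition.transpose i j \<circ> id))"
    by (intro sum_mono2 sum_nonneg mult_nonneg_nonneg p_nonneg move_prob_nonneg) auto
  also have "\<dots> \<le> (\<Sum>i\<in>U. \<Sum>j\<in>U. p i * p j * move_prob t S (Transposition.transpose i j \<circ> id))"
    by (intro sum_mono sum_mono2 sum_nonneg mult_nonneg_nonneg p_nonneg move_prob_nonneg) auto
  finally show ?thesis unfolding move_prob_Suc .
qed

text \<open>The left side is the probability that none of \<open>2 * t\<close> draws hits
  \<open>S\<close>.\<close>

lemma move_prob_id_ge:
  assumes "S \<subseteq> U"
  shows "(1 - sum p S) ^ (2 * t) \<le> move_prob t S id"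
proof (induction t)
  case 0 then show ?case by (simp add: move_prob_0)
next
  case (Suc t)
  have "(1 - sum p S) ^ (2 * Suc t) = (1 - sum p S)\<^sup>2 * (1 - sum p S) ^ (2 * t)"
    by (simp add: power2_eq_square)
  also have "\<dots> \<le> (1 - sum p S)\<^sup>2 * move_prob t S id" by (rule mult_left_mono[OF Suc.IH]) simp
  also have "\<dots> \<le> move_prob (Suc t) S id" by (rule move_prob_id_Suc_ge[OF assms])
  finally show ?case .
qed

section \<open>Spectral form of the one-card chain\<close>

definition \<rho> :: real where "\<rho> = 1 - a * b / n"

text \<open>The probability that a single card moves from \<open>x\<close> to \<open>y\<close> in \<open>t\<close> steps, read off the spectral
  decomposition: \<open>1 - 2 p y\<close> on functions with sum zero supported in \<open>A\<close> or in \<open>B\<close>, \<open>1\<close> on constants and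
  \<open>\<rho>\<close> on the difference of the indicators of \<open>A\<close> and \<open>B\<close>.\<close>

definition r :: "nat \<Rightarrow> nat \<Rightarrow> nat \<Rightarrow> real" where
  "r t x y = (if x = y then (1 - 2 * p y) ^ t else 0)
     + (if (x \<in> A) = (y \<in> A) then (1 + \<rho> ^ t) / 2 - (1 - 2 * p y) ^ t else (1 - \<rho> ^ t) / 2) / n"

lemma rho_bounds: "0 \<le> \<rho>" "\<rho> \<le> 1"
proof -
  have "a * b / n \<le> 1 / 1"
    using ab_le_1 n_pos b_pos a_pos by (intro frac_le) auto
  then show "0 \<le> \<rho>" "\<rho> \<le> 1" unfolding \<rho>_def using b_pos a_pos by auto
qed

lemma rho_pow: "0 \<le> \<rho> ^ t" "\<rho> ^ t \<le> 1"
  using rho_bounds by (auto intro: power_le_one)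

text \<open>On \<open>U\<close>, \<open>p\<close> is the constant \<open>1 / (2 * n)\<close> plus
  \<open>(a - b) / 2 / (2 * n)\<close> times the difference of the indicators of \<open>A\<close>
  and \<open>B\<close>; these two functions have eigenvalues \<open>1\<close> and
  \<open>\<rho>\<close>.\<close>

lemma sum_p_r:
  assumes "x \<in> U"
  shows "(\<Sum>z\<in>U. p z * r t x z) = (1 + (if x \<in> A then (a - b) / 2 else - ((a - b) / 2)) * \<rho> ^ t) / (2 * n)"
proof -
  have xAB: "x \<in> A \<longleftrightarrow> x \<notin> B" using assms AB by auto
  have block: "(\<Sum>z\<in>C. q * ((if x = z then d else 0) + e / n)) = q * ((if x \<in> C then d else 0) + e)"
    if "finite C" "card C = n" for C and q d e :: real
    unfolding sum_distrib_left[symmetric] sum.distrib using that n_pos by simp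
  have "(\<Sum>z\<in>A. p z * r t x z) = (\<Sum>z\<in>A. a / (2 * n) * ((if x = z then (1 - a / n) ^ t else 0)
     + (if x \<in> A then (1 + \<rho> ^ t) / 2 - (1 - a / n) ^ t else (1 - \<rho> ^ t) / 2) / n))"
    by (intro sum.cong refl) (simp add: r_def p_def)
  also have "\<dots> = a / (2 * n) * (if x \<in> A then (1 + \<rho> ^ t) / 2 else (1 - \<rho> ^ t) / 2)"
    by (subst block) (use fin_AB card_AB in auto)
  finally have 1: "(\<Sum>z\<in>A. p z * r t x z) = a / (2 * n) * (if x \<in> A then (1 + \<rho> ^ t) / 2 else (1 - \<rho> ^ t) / 2)" .
  have "(\<Sum>z\<in>B. p z * r t x z) = (\<Sum>z\<in>B. b / (2 * n) * ((if x = z then (1 - b / n) ^ t else 0)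
     + (if x \<in> B then (1 + \<rho> ^ t) / 2 - (1 - b / n) ^ t else (1 - \<rho> ^ t) / 2) / n))"
  proof (intro sum.cong refl)
    fix z assume "z \<in> B"
    then have "z \<notin> A" using AB by auto
    then show "p z * r t x z = b / (2 * n) * ((if x = z then (1 - b / n) ^ t else 0)
     + (if x \<in> B then (1 + \<rho> ^ t) / 2 - (1 - b / n) ^ t else (1 - \<rho> ^ t) / 2) / n)"
      using \<open>z \<in> B\<close> xAB by (simp add: r_def p_def)
  qed
  also have "\<dots> = b / (2 * n) * (if x \<in> B then (1 + \<rho> ^ t) / 2 else (1 - \<rho> ^ t) / 2)"
    by (subst block) (use fin_AB card_AB in auto)
  finally have 2: "(\<Sum>z\<in>B. p z * r t x z) = b / (2 * n) * (if x \<in> B then (1 + \<rho> ^ t) / 2 else (1 - \<rho> ^ t) / 2)" .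
  define c where "c = 1 / (2 * real n)"
  have cn: "z / (2 * real n) = z * c" "z / real (2 * n) = z * c" for z by (simp_all add: c_def)
  have a: "a = 2 - b" using ab by simp
  define R where "R = \<rho> ^ t"
  show ?thesis unfolding sum_split 1 2 cn R_def[symmetric] using xAB
    by (cases "x \<in> A") (simp_all add: a field_simps)
qed

lemma sum_p_r_le:
  assumes "x \<in> U"
  shows "(\<Sum>z\<in>U. p z * r t x z) \<le> 1 / n"
proof -
  define c where "c = (if x \<in> A then (a - b) / 2 else - ((a - b) / 2))"
  have "\<bar>c\<bar> \<le> 1" "\<bar>\<rho> ^ t\<bar> \<le> 1"
    using b_pos b_le_a a_less_2 rho_pow[of t] by (auto simp: c_def abs_of_nonneg simp del: power_abs)
  then have "\<bar>c * \<rho> ^ t\<bar> \<le> 1 * 1" unfolding abs_mult by (intro mult_mono) auto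
  then have "c * \<rho> ^ t \<le> 1" by simp
  then show ?thesis unfolding sum_p_r[OF assms] c_def[symmetric] using n_pos by (simp add: field_simps)
qed

text \<open>The one-card transition matrix is the diagonal \<open>1 - 2 * p y\<close> plus the rank
  one matrix \<open>2 * p z * p y\<close>, whose diagonal accounts for drawing \<open>y\<close>
  twice. Together with the start \<open>r_0\<close> this characterises the closed form
  \<open>r\<close>.\<close>

lemma r_Suc:
  assumes "x \<in> U" "y \<in> U"
  shows "r (Suc t) x y = (1 - 2 * p y) * r t x y + 2 * p y * (\<Sum>z\<in>U. p z * r t x z)"
proof -
  have a: "a = 2 - b" using ab by simp
  have py: "p y = (if y \<in> A then a else b) / (2 * n)" using assms AB by (auto simp: p_def)
  define P where "P = (1 - 2 * p y) ^ t"
  define R where "R = \<rho> ^ t"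
  define c where "c = 1 / real n"
  have cn: "z / real n = z * c" "z / real (2 * n) = z * c / 2" for z by (simp_all add: c_def)
  have rs: "\<rho> ^ Suc t = (1 - (2 - b) * b * c) * R" unfolding R_def \<rho>_def by (simp add: a c_def)
  have ps: "(1 - 2 * p y) ^ Suc t = (1 - 2 * p y) * P" unfolding P_def by simp
  show ?thesis
    unfolding sum_p_r[OF assms(1)] unfolding r_def rs ps
    unfolding P_def[symmetric] R_def[symmetric] unfolding py cn unfolding a
    by (cases "y \<in> A"; cases "x \<in> A"; cases "x = y") (simp_all add: field_simps)
qed

end

section \<open>Upper bounds for return probabilities\<close>

text \<open>Elementary symmetric polynomials are bounded by powers of the first one. Sorting the
  subsets by whether they contain the new element \<open>x\<close> leaves the first two terms of the
  expansion of \<open>(s + f x) ^ k\<close>.\<close>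

lemma sum_prod_subsets_le:
  fixes f :: "'a \<Rightarrow> real"
  assumes "finite X" "\<And>x. x \<in> X \<Longrightarrow> 0 \<le> f x"
  shows "(\<Sum>S | S \<subseteq> X \<and> card S = k. \<Prod>x\<in>S. f x) \<le> (\<Sum>x\<in>X. f x) ^ k / fact k"
  using assms
proof (induction X arbitrary: k)
  case empty
  have "{S. S \<subseteq> {} \<and> card S = k} = (if k = 0 then {{}} else {} :: 'a set set)" by auto
  then show ?case by (simp add: power_0_left)
next
  case (insert x X)
  define s where "s = (\<Sum>x\<in>X. f x)"
  have s0: "0 \<le> s" unfolding s_def using insert.prems by (intro sum_nonneg) auto
  have fx: "0 \<le> f x" using insert.prems by auto
  show ?case
  proof (cases k)
    case 0
    have "{S. S \<subseteq> insert x X \<and> card S = 0} = {{}}"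
      using insert.hyps by (auto dest: finite_subset)
    then show ?thesis using 0 by simp
  next
    case (Suc k')
    have split: "{S. S \<subseteq> insert x X \<and> card S = k} =
       {S. S \<subseteq> X \<and> card S = k} \<union> insert x ` {S. S \<subseteq> X \<and> card S = k'}" (is "?L = ?R1 \<union> ?R2")
    proof (intro equalityI subsetI)
      fix S assume S: "S \<in> ?L"
      show "S \<in> ?R1 \<union> ?R2"
      proof (cases "x \<in> S")
        case True
        then have "S = insert x (S - {x})" "S - {x} \<subseteq> X" using S by auto
        moreover have "card (S - {x}) = k'" using True S Suc by simp
        ultimately show ?thesis by blast
      next
        case False then show ?thesis using S by auto
      qed
    next
      fix S assume "S \<in> ?R1 \<union> ?R2"
      then show "S \<in> ?L"
      proof
        assume "S \<in> ?R2"
        then obtain T where T: "T \<subseteq> X" "card T = k'" "S = insert x T" by auto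
        then have "x \<notin> T" "finite T" using insert.hyps finite_subset by auto
        then show ?thesis using T Suc by auto
      qed auto
    qed
    have finX: "finite {S. S \<subseteq> X \<and> card S = j}" for j using insert.hyps by simp
    have disj: "?R1 \<inter> ?R2 = {}" using insert.hyps by auto
    have inj: "inj_on (insert x) {S. S \<subseteq> X \<and> card S = k'}"
      using insert.hyps by (auto simp: inj_on_def)
    have ins: "(\<Prod>x\<in>insert x S. f x) = f x * (\<Prod>x\<in>S. f x)" if "S \<subseteq> X" for S
      using that insert.hyps finite_subset by (subst prod.insert) auto
    have "(\<Sum>S\<in>?L. \<Prod>x\<in>S. f x) = (\<Sum>S | S \<subseteq> X \<and> card S = k. \<Prod>x\<in>S. f x)
        + f x * (\<Sum>S | S \<subseteq> X \<and> card S = k'. \<Prod>x\<in>S. f x)"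
      unfolding split using finX disj
      by (subst sum.union_disjoint) (auto simp: sum.reindex[OF inj] ins sum_distrib_left)
    also have "\<dots> \<le> s ^ k / fact k + f x * (s ^ k' / fact k')"
      unfolding s_def using insert fx by (intro add_mono mult_left_mono) auto
    also have "\<dots> = (s ^ Suc k' + real (Suc k') * f x * s ^ k') / fact (Suc k')"
    proof -
      have "f x * (s ^ k' / fact k') = real (Suc k') * f x * s ^ k' / fact (Suc k')"
        by (simp add: fact_Suc del: of_nat_Suc)
      then show ?thesis by (simp only: Suc add_divide_distrib)
    qed
    also have "\<dots> \<le> (s + f x) ^ Suc k' / fact (Suc k')"
    proof (rule divide_right_mono)
      show "s ^ Suc k' + real (Suc k') * f x * s ^ k' \<le> (s + f x) ^ Suc k'"
        using s0 fx
      proof (induction k')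
        case (Suc m)
        have "s ^ Suc (Suc m) + real (Suc (Suc m)) * f x * s ^ Suc m
          \<le> (s ^ Suc m + real (Suc m) * f x * s ^ m) * (s + f x)"
          using Suc.prems by (simp add: algebra_simps)
        also have "\<dots> \<le> (s + f x) ^ Suc m * (s + f x)"
          using Suc by (intro mult_right_mono) auto
        finally show ?case by (simp only: power_Suc2)
      qed simp
    qed simp
    finally show ?thesis using insert.hyps by (simp add: s_def Suc add.commute)
  qed
qed

lemma expectation_num_fixed_choose:
  assumes fin: "finite (set_pmf M)"
  shows "measure_pmf.expectation (map_pmf (num_fixed N) M) (\<lambda>x. real (x choose k)) =
    (\<Sum>S | S \<subseteq> {1..N} \<and> card S = k. measure_pmf.prob M {\<sigma>. \<forall>i\<in>S. \<sigma> i = i})"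
proof -
  let ?Q = "{S. S \<subseteq> {1..N} \<and> card S = k}"
  have "real (num_fixed N \<sigma> choose k) = (\<Sum>S\<in>?Q. indicator {\<sigma>. \<forall>i\<in>S. \<sigma> i = i} \<sigma>)" for \<sigma>
  proof -
    have "num_fixed N \<sigma> choose k = card {S. S \<subseteq> {i \<in> {1..N}. \<sigma> i = i} \<and> card S = k}"
      unfolding num_fixed_def by (rule n_subsets[symmetric]) simp
    also have "{S. S \<subseteq> {i \<in> {1..N}. \<sigma> i = i} \<and> card S = k} = {S \<in> ?Q. \<forall>i\<in>S. \<sigma> i = i}" by auto
    also have "real (card \<dots>) = (\<Sum>S\<in>?Q. indicator {\<sigma>. \<forall>i\<in>S. \<sigma> i = i} \<sigma>)"
      by (simp add: indicator_def sum.If_cases Int_def conj_commute)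
    finally show ?thesis .
  qed
  then have "measure_pmf.expectation (map_pmf (num_fixed N) M) (\<lambda>x. real (x choose k)) =
     measure_pmf.expectation M (\<lambda>\<sigma>. \<Sum>S\<in>?Q. indicator {\<sigma>. \<forall>i\<in>S. \<sigma> i = i} \<sigma>)"
    by simp
  also have "\<dots> = (\<Sum>S\<in>?Q. measure_pmf.expectation M (indicator {\<sigma>. \<forall>i\<in>S. \<sigma> i = i}))"
    by (intro Bochner_Integration.integral_sum integrable_measure_pmf_finite fin)
  finally show ?thesis by simp
qed

text \<open>Starting from 0, this is the result of \<open>t\<close> rounds of
  \<open>b := (1 + b) * (1 + K) - 1\<close> from \<open>step_majorant\<close> with
  \<open>K = (k / n)\<^sup>2 * (2 + 2 ^ k)\<close>; here \<open>k / n\<close> bounds the chance that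
  one draw hits \<open>k\<close> tracked cards.\<close>

definition swap_error :: "nat \<Rightarrow> nat \<Rightarrow> nat \<Rightarrow> real" where
  "swap_error n k t = (1 + (real k / real n)\<^sup>2 * (2 + 2 ^ k)) ^ t - 1"

text \<open>Bounds every entry of the corrected kernel \<open>u k t\<close> once
  \<open>4 \<le> n\<close>; it is of order \<open>1 / n\<close> at the time of the theorem.\<close>

definition entry_bound :: "real \<Rightarrow> nat \<Rightarrow> nat \<Rightarrow> nat \<Rightarrow> real" where
  "entry_bound b n k t = (1 - b / real n) ^ t + 1 / real n + 16 * real k * real t / real n ^ 3"

context biased_deck
begin

section \<open>Kernel estimates and domination of the tracked cards\<close>

lemma p_half: "4 \<le> n \<Longrightarrow> 1 / 2 \<le> 1 - 2 * p x"
proof -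
  assume "4 \<le> n"
  then have "1 / n \<le> 1 / real 4" by (intro divide_left_mono) auto
  then show ?thesis using p_le[of x] by simp
qed

lemma r_0: "r 0 x y = (if x = y then 1 else 0)" by (simp add: r_def)

lemma r_nonneg:
  assumes "4 \<le> n" "x \<in> U" "y \<in> U"
  shows "0 \<le> r t x y"
  using assms(3)
proof (induction t arbitrary: y)
  case (Suc t)
  have "0 \<le> 1 - 2 * p y" using p_half[OF assms(1), of y] by simp
  then show ?case
    unfolding r_Suc[OF assms(2) Suc.prems] using Suc p_nonneg
    by (intro add_nonneg_nonneg mult_nonneg_nonneg sum_nonneg) auto
qed (simp add: r_0)

definition d :: real where "d = 1 - b / n"

lemma r_le:
  assumes "4 \<le> n" "y \<in> U"
  shows "r t x y \<le> d ^ t + 1 / n"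
proof -
  define P where "P = (1 - 2 * p y) ^ t"
  have p0: "0 \<le> P" unfolding P_def using p_half[OF assms(1), of y] by simp
  have pd: "P \<le> d ^ t" unfolding P_def
  proof (rule power_mono)
    have "b / n \<le> a / n" using b_le_a by (intro divide_right_mono) auto
    then show "1 - 2 * p y \<le> d" using assms(2) AB by (auto simp: p_def d_def)
  qed (use p_half[OF assms(1), of y] in simp)
  have "(if (x \<in> A) = (y \<in> A) then (1 + \<rho> ^ t) / 2 - P else (1 - \<rho> ^ t) / 2) \<le> 1"
    using p0 rho_pow[of t] by (simp add: field_simps)
  then have "(if (x \<in> A) = (y \<in> A) then (1 + \<rho> ^ t) / 2 - P else (1 - \<rho> ^ t) / 2) / n \<le> 1 / n"
    by (intro divide_right_mono) auto
  moreover have "(if x = y then P else 0) \<le> d ^ t" using p0 pd by auto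
  ultimately show ?thesis unfolding r_def P_def[symmetric] by (rule add_mono[rotated])
qed

text \<open>The trace is the sum of the \<open>t\<close>-th powers of the eigenvalues:
  \<open>1\<close> and \<open>\<rho>\<close> once each, \<open>1 - a / n\<close> and
  \<open>d\<close> with multiplicity \<open>n - 1\<close> each.\<close>

lemma sum_r_diag:
  "(\<Sum>x\<in>U. r t x x) = 1 + \<rho> ^ t + (real n - 1) * ((1 - a / n) ^ t + d ^ t)"
proof -
  define P where "P = (1 - a / n) ^ t"
  have "(\<Sum>x\<in>A. r t x x) = (\<Sum>x\<in>A. P + ((1 + \<rho> ^ t) / 2 - P) / n)"
    by (intro sum.cong refl) (simp add: r_def p_def P_def)
  moreover have "(\<Sum>x\<in>B. r t x x) = (\<Sum>x\<in>B. d ^ t + ((1 + \<rho> ^ t) / 2 - d ^ t) / n)"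
    using AB(2) by (intro sum.cong refl) (auto simp: r_def p_def d_def)
  moreover have block: "(\<Sum>x\<in>C. q + e / n) = n * q + e" if "card C = n" for C :: "nat set" and q e :: real
    using that n_pos by (simp add: algebra_simps)
  ultimately show ?thesis unfolding sum_split P_def[symmetric]
    by (simp only: block[OF card_AB(1)] block[OF card_AB(2)]) (simp add: field_simps)
qed

text \<open>The added term is a supersolution correction: it absorbs the factor \<open>1 + 4 k / n\<close> in \<open>single_moves_le_prod\<close>.\<close>

definition u :: "nat \<Rightarrow> nat \<Rightarrow> nat \<Rightarrow> nat \<Rightarrow> real" where
  "u k t x y = r t x y + 16 * real k * real t / real n ^ 3"

lemma swap_error_nonneg: "0 \<le> swap_error n k t"
  unfolding swap_error_def by (simp add: one_le_power)

text \<open>Inserting the factor \<open>1 + 4 * k / n\<close> costs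
  \<open>8 * k / n * (p z * (R + e))\<close>. The bound on \<open>t\<close> gives
  \<open>e \<le> 1 / n\<close>, and \<open>p z\<close> and \<open>R\<close> are at most
  \<open>1 / n\<close> too, so the cost stays within the increment \<open>16 * k / n ^ 3\<close> of
  the correction.\<close>

lemma u_Suc_ge:
  assumes n: "4 \<le> n" and t: "16 * k * t \<le> n\<^sup>2" and x: "x \<in> U" and z: "z \<in> U"
  shows "(1 - 2 * p z) * u k t x z + 2 * (1 + 4 * real k / real n) * p z * (\<Sum>w\<in>U. p w * u k t x w) \<le> u k (Suc t) x z"
proof -
  define e where "e = 16 * real k * real t / real n ^ 3"
  define R where "R = (\<Sum>w\<in>U. p w * r t x w)"
  have "real (16 * k * t) \<le> real (n\<^sup>2)" using t by (intro of_nat_mono)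
  then have "e \<le> real n ^ 2 / real n ^ 3" unfolding e_def by (intro divide_right_mono) simp_all
  then have e: "e \<le> 1 / n" using n_pos by (simp add: power2_eq_square power3_eq_cube)
  have e0: "0 \<le> e" unfolding e_def by simp
  have "(\<Sum>w\<in>U. p w * u k t x w) = R + sum p U * e"
    unfolding u_def R_def e_def[symmetric] sum_distrib_right sum.distrib[symmetric] by (simp add: distrib_left)
  then have suw: "(\<Sum>w\<in>U. p w * u k t x w) = R + e" unfolding sum_p by simp
  have "(1 - 2 * p z) * u k t x z + 2 * (1 + 4 * real k / real n) * p z * (\<Sum>w\<in>U. p w * u k t x w)
    = r (Suc t) x z + e + (8 * real k / real n) * (p z * (R + e))"
    unfolding suw r_Suc[OF x z] R_def[symmetric] unfolding u_def e_def[symmetric]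
    by (simp add: algebra_simps add_divide_distrib)
  also have "\<dots> \<le> r (Suc t) x z + e + (8 * real k / real n) * (1 / n * (1 / n + 1 / n))"
    using sum_p_r_le[OF x, of t] e e0 p_le[of z] p_nonneg r_nonneg[OF n x]
    unfolding R_def[symmetric]
    by (intro add_mono mult_left_mono mult_mono) (auto simp: R_def intro!: add_nonneg_nonneg sum_nonneg mult_nonneg_nonneg)
  also have "\<dots> = u k (Suc t) x z"
    unfolding u_def e_def using n_pos by (simp add: field_simps power3_eq_cube)
  finally show ?thesis .
qed

lemma u_nonneg: "4 \<le> n \<Longrightarrow> x \<in> U \<Longrightarrow> y \<in> U \<Longrightarrow> 0 \<le> u k t x y"
  unfolding u_def using r_nonneg by simp

text \<open>Induction on \<open>t\<close> for all injective targets at once, since undoing the last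
  transposition changes \<open>y\<close>. Each round is \<open>step_majorant\<close> with
  \<open>g = 4 * k / n\<close>.\<close>

lemma move_prob_le_majorant:
  assumes S: "S \<subseteq> U" "card S = k" and n: "4 \<le> n" "4 * k \<le> n" and t: "16 * k * t \<le> n\<^sup>2"
    and y: "inj_on y S" "y ` S \<subseteq> U"
  shows "move_prob t S y \<le> (\<Prod>l\<in>S. u k t l (y l)) + swap_error n k t * perm_majorant (u k t) S y"
  using t y
proof (induction t arbitrary: y)
  case 0
  have u0: "0 \<le> u k 0 l (y m)" if "l \<in> S" "m \<in> S" for l m
    using that 0 S n by (intro u_nonneg) auto
  have "move_prob 0 S y = (\<Prod>l\<in>S. u k 0 l (y l))" if "\<forall>i\<in>S. y i = i"
    unfolding move_prob_0 using that by (simp add: u_def r_0)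
  moreover have "0 \<le> (\<Prod>l\<in>S. u k 0 l (y l))" using u0 by (intro prod_nonneg) auto
  ultimately show ?case by (auto simp: swap_error_def move_prob_0)
next
  case (Suc t)
  have fin: "finite S" using S finite_subset by blast
  have t: "16 * k * t \<le> n\<^sup>2" using Suc.prems(1) by simp
  let ?s = "\<Sum>l\<in>S. p (y l)"
  have "?s \<le> (\<Sum>l\<in>S. 1 / real n)" by (intro sum_mono p_le)
  then have s: "?s \<le> k / n" using S by simp
  have s0: "0 \<le> ?s" by (intro sum_nonneg p_nonneg)
  have kn: "4 * (real k / n) \<le> 1"
  proof -
    have "real (4 * k) / n \<le> real n / n" using n(2) by (intro divide_right_mono of_nat_mono) auto
    then show ?thesis using n_pos by simp
  qed
  \<comment> \<open>As \<open>?s \<le> k / n\<close>, the claim reduces with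
    \<open>x = 2 * k / n\<close> to \<open>1 \<le> (1 + 2 * x) * (1 - x)\<close>, true for
    \<open>x\<close> between 0 and \<open>1 / 2\<close>.\<close>
  have g: "1 \<le> (1 + 4 * real k / real n) * (1 - 2 * ?s)"
  proof -
    define x where "x = 2 * real k / n"
    have x: "0 \<le> x" "2 * x \<le> 1" using kn by (auto simp: x_def)
    have "0 \<le> x * (1 - 2 * x)" using x by simp
    then have "1 \<le> (1 + 2 * x) * (1 - x)" by (simp add: algebra_simps)
    also have "\<dots> \<le> (1 + 2 * x) * (1 - 2 * ?s)" using s x by (intro mult_left_mono) (auto simp: x_def)
    finally show ?thesis by (simp add: x_def)
  qed
  have K: "?s\<^sup>2 * (2 + 2 ^ card S) \<le> (k / n)\<^sup>2 * (2 + 2 ^ k)"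
    unfolding S using s s0 by (intro mult_right_mono power_mono) auto
  have uv: "u k t l z \<le> 2 * u k (Suc t) l z" if "l \<in> S" "z \<in> U" for l z
  proof -
    have l: "l \<in> U" using that S by auto
    have "1 / 2 * u k t l z \<le> (1 - 2 * p z) * u k t l z"
      using u_nonneg[OF n(1) l that(2)] p_half[OF n(1)] by (intro mult_right_mono) auto
    also have "\<dots> \<le> (1 - 2 * p z) * u k t l z + 2 * (1 + 4 * real k / real n) * p z * (\<Sum>w\<in>U. p w * u k t l w)"
      using u_nonneg[OF n(1) l] p_nonneg
      by (simp only: le_add_same_cancel1) (intro mult_nonneg_nonneg sum_nonneg; simp)
    also have "\<dots> \<le> u k (Suc t) l z" by (rule u_Suc_ge[OF n(1) t l that(2)])
    finally show ?thesis by simp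
  qed
  have "move_prob (Suc t) S y = (\<Sum>i\<in>U. \<Sum>j\<in>U. p i * p j * move_prob t S (Transposition.transpose i j \<circ> y))"
    by (rule move_prob_Suc)
  also have "\<dots> \<le> (\<Sum>i\<in>U. \<Sum>j\<in>U. p i * p j * ((\<Prod>l\<in>S. u k t l ((Transposition.transpose i j \<circ> y) l))
      + swap_error n k t * perm_majorant (u k t) S (Transposition.transpose i j \<circ> y)))"
  proof (intro sum_mono mult_left_mono Suc.IH t mult_nonneg_nonneg p_nonneg)
    fix i j assume ij: "i \<in> U" "j \<in> U"
    show "inj_on (Transposition.transpose i j \<circ> y) S"
      using Suc.prems(2) by (intro comp_inj_on inj_on_subset[OF inj_transpose]) auto
    have "Transposition.transpose i j z \<in> U" if "z \<in> U" for z
      using that ij by (simp add: Transposition.transpose_def)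
    then show "(Transposition.transpose i j \<circ> y) ` S \<subseteq> U" using Suc.prems(3) by auto
  qed
  also have "\<dots> \<le> (\<Prod>l\<in>S. u k (Suc t) l (y l))
     + ((1 + swap_error n k t) * (1 + (k / n)\<^sup>2 * (2 + 2 ^ k)) - 1) * perm_majorant (u k (Suc t)) S y"
  proof (rule step_majorant[where g = "4 * real k / real n"])
    show "4 * ?s \<le> 1" using s kn by simp
  qed (use fin Suc.prems sum_p p_nonneg g K uv swap_error_nonneg S u_nonneg[OF n(1)] u_Suc_ge[OF n(1) t] in auto)
  also have "(1 + swap_error n k t) * (1 + (k / n)\<^sup>2 * (2 + 2 ^ k)) - 1 = swap_error n k (Suc t)"
    by (simp add: swap_error_def mult.commute)
  finally show ?case .
qed

lemma perm_majorant_le: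
  assumes S: "S \<subseteq> U" "card S = k" and n: "4 \<le> n"
  shows "perm_majorant (u m t) S id \<le> fact k * entry_bound b n m t ^ k"
proof -
  have fin: "finite S" using S finite_subset by blast
  have "perm_majorant (u m t) S id \<le> (\<Sum>\<pi> | \<pi> permutes S. \<Prod>l\<in>S. entry_bound b n m t)"
    unfolding perm_majorant_def
  proof (intro sum_mono prod_mono conjI)
    fix \<pi> l assume "\<pi> \<in> {\<pi>. \<pi> permutes S}" "l \<in> S"
    then have "l \<in> S" "\<pi> l \<in> S" by (auto simp: permutes_in_image)
    then have "l \<in> U" "\<pi> l \<in> U" using S by blast+
    then show "0 \<le> u m t l (id (\<pi> l))" "u m t l (id (\<pi> l)) \<le> entry_bound b n m t"
      using u_nonneg[OF n] r_le[OF n, of "\<pi> l" t l] by (auto simp: u_def entry_bound_def d_def)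
  qed
  then show ?thesis using S fin by (simp add: card_permutations)
qed

lemma move_prob_id_le_entry_bound:
  assumes S: "S \<subseteq> U" "card S = k" and n: "4 \<le> n" "4 * k \<le> n" and t: "16 * k * t \<le> n\<^sup>2"
  shows "move_prob t S id \<le> (1 + swap_error n k t * fact k) * entry_bound b n k t ^ k"
proof -
  have fin: "finite S" using S finite_subset by blast
  have "move_prob t S id \<le> (\<Prod>l\<in>S. u k t l (id l)) + swap_error n k t * perm_majorant (u k t) S id"
    using S by (intro move_prob_le_majorant n t) auto
  also have "\<dots> \<le> entry_bound b n k t ^ k + swap_error n k t * (fact k * entry_bound b n k t ^ k)"
  proof (intro add_mono mult_left_mono perm_majorant_le S n swap_error_nonneg)
    have "(\<Prod>l\<in>S. u k t l (id l)) \<le> (\<Prod>l\<in>S. entry_bound b n k t)"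
    proof (intro prod_mono conjI)
      fix l assume "l \<in> S"
      then have "l \<in> U" using S by auto
      then show "0 \<le> u k t l (id l)" "u k t l (id l) \<le> entry_bound b n k t"
        using u_nonneg[OF n(1)] r_le[OF n(1), of l t l] by (auto simp: u_def entry_bound_def d_def)
    qed
    then show "(\<Prod>l\<in>S. u k t l (id l)) \<le> entry_bound b n k t ^ k" using S by simp
  qed
  finally show ?thesis by (simp add: algebra_simps)
qed

text \<open>The products are summed by \<open>sum_prod_subsets_le\<close>, which brings in the
  trace; for the permanents a crude entrywise bound suffices, because they carry the factor
  \<open>swap_error\<close>.\<close>

lemma sum_move_prob_le:
  assumes n: "4 \<le> n" "4 * k \<le> n" and t: "16 * k * t \<le> n\<^sup>2"
  shows "(\<Sum>S | S \<subseteq> U \<and> card S = k. move_prob t S id) \<le>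
     (1 + \<rho> ^ t + (real n - 1) * ((1 - a / n) ^ t + d ^ t) + 32 * real k * real t / real n ^ 2) ^ k / fact k
     + swap_error n k t * (2 * n * entry_bound b n k t) ^ k"
proof -
  let ?Q = "{S. S \<subseteq> U \<and> card S = k}"
  have M0: "0 \<le> entry_bound b n k t" unfolding entry_bound_def using b_le_1 n
    by (intro add_nonneg_nonneg zero_le_power) (auto simp: field_simps)
  have "(\<Sum>S\<in>?Q. move_prob t S id) \<le> (\<Sum>S\<in>?Q. (\<Prod>l\<in>S. u k t l l) + swap_error n k t * (fact k * entry_bound b n k t ^ k))"
  proof (rule sum_mono)
    fix S assume "S \<in> ?Q"
    then have S: "S \<subseteq> U" "card S = k" by auto
    have "move_prob t S id \<le> (\<Prod>l\<in>S. u k t l (id l)) + swap_error n k t * perm_majorant (u k t) S id"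
      using S by (intro move_prob_le_majorant n t) auto
    also have "\<dots> \<le> (\<Prod>l\<in>S. u k t l l) + swap_error n k t * (fact k * entry_bound b n k t ^ k)"
      using S n by (intro add_mono mult_left_mono perm_majorant_le swap_error_nonneg) auto
    finally show "move_prob t S id \<le> (\<Prod>l\<in>S. u k t l l) + swap_error n k t * (fact k * entry_bound b n k t ^ k)" .
  qed
  also have "\<dots> = (\<Sum>S\<in>?Q. \<Prod>l\<in>S. u k t l l) + real ((2 * n) choose k) * (swap_error n k t * (fact k * entry_bound b n k t ^ k))"
    by (simp add: sum.distrib n_subsets)
  also have "\<dots> \<le> (\<Sum>x\<in>U. u k t x x) ^ k / fact k + swap_error n k t * (2 * n * entry_bound b n k t) ^ k"
  proof (rule add_mono)
    show "(\<Sum>S\<in>?Q. \<Prod>l\<in>S. u k t l l) \<le> (\<Sum>x\<in>U. u k t x x) ^ k / fact k"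
      using u_nonneg[OF n(1)] by (intro sum_prod_subsets_le) auto
    have "((2 * n) choose k) * fact k \<le> (2 * n) ^ k"
      using binomial_fact_pow[of "2 * n" k] by simp
    then have "real (((2 * n) choose k) * fact k) \<le> real ((2 * n) ^ k)" by (rule of_nat_mono)
    then have "(real ((2 * n) choose k) * fact k) * (swap_error n k t * entry_bound b n k t ^ k) \<le> (2 * real n) ^ k * (swap_error n k t * entry_bound b n k t ^ k)"
      using swap_error_nonneg M0 by (intro mult_right_mono) (auto)
    then show "real ((2 * n) choose k) * (swap_error n k t * (fact k * entry_bound b n k t ^ k)) \<le> swap_error n k t * (2 * n * entry_bound b n k t) ^ k"
      by (simp add: power_mult_distrib mult_ac)
  qed
  also have "(\<Sum>x\<in>U. u k t x x) = 1 + \<rho> ^ t + (real n - 1) * ((1 - a / n) ^ t + d ^ t) + 32 * real k * real t / real n ^ 2"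
    unfolding u_def sum.distrib sum_r_diag using n_pos by (simp add: power2_eq_square power3_eq_cube)
  finally show ?thesis .
qed

end

section \<open>Lower bounds for return probabilities\<close>

context biased_deck
begin

section \<open>Time reversal and agreement of two copies\<close>

lemma law_permutes: "\<sigma> \<in> set_pmf (law t) \<Longrightarrow> \<sigma> permutes U"
proof (induction t arbitrary: \<sigma>)
  case 0 then show ?case by (auto simp: permutes_def)
next
  case (Suc t)
  have card_U: "x \<in> U" if "x \<in> set_pmf (biased_card a b (2 * n) A B)" for x
    using that unfolding AB(1)[symmetric] set_pmf_iff pmf_card p_def by (auto split: if_splits)
  obtain i j \<pi> where *: "\<pi> \<in> set_pmf (law t)" "i \<in> set_pmf (biased_card a b (2 * n) A B)"
      "j \<in> set_pmf (biased_card a b (2 * n) A B)" "\<sigma> = Transposition.transpose i j \<circ> \<pi>"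
    using Suc.prems by (auto simp: shuffle_step_def)
  show ?case unfolding *(4)
    using Suc.IH[OF *(1)] card_U[OF *(2)] card_U[OF *(3)]
    by (intro permutes_compose[of \<pi>] permutes_swap_id)
qed

lemma finite_law: "finite (set_pmf (law t))"
  by (rule finite_subset[of _ "{\<sigma>. \<sigma> permutes U}"]) (auto dest: law_permutes intro: finite_permutations)

lemma shuffle_add: "law (s + t) = bind_pmf (law t) (\<lambda>\<sigma>. map_pmf (\<lambda>\<pi>. \<pi> \<circ> \<sigma>) (law s))"
proof (induction s)
  case 0 then show ?case by (simp add: bind_return_pmf')
next
  case (Suc s)
  have step: "map_pmf (\<lambda>\<pi>'. \<pi>' \<circ> \<sigma>) (shuffle_step a b (2 * n) A B \<pi>) = shuffle_step a b (2 * n) A B (\<pi> \<circ> \<sigma>)"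
    for \<pi> \<sigma>
    unfolding shuffle_step_def map_pmf_comp by (intro map_pmf_cong) (auto simp: comp_assoc)
  have "law (Suc s + t) = bind_pmf (law t) (\<lambda>\<sigma>. bind_pmf (law s) (\<lambda>\<pi>. shuffle_step a b (2 * n) A B (\<pi> \<circ> \<sigma>)))"
    by (simp add: Suc bind_assoc_pmf bind_map_pmf comp_def)
  then show ?case by (simp only: shuffle.simps map_bind_pmf step)
qed

text \<open>Inversion reverses the order of the transpositions, and the steps are independent and
  identically distributed.\<close>

lemma map_inv_law: "map_pmf inv (law t) = law t"
proof (induction t)
  case 0 then show ?case by simp
next
  case (Suc t)
  let ?cc = "pair_pmf (biased_card a b (2 * n) A B) (biased_card a b (2 * n) A B)"
  have "map_pmf inv (law (Suc t)) = bind_pmf ?cc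
     (\<lambda>(i, j). map_pmf (\<lambda>\<sigma>. \<sigma> \<circ> Transposition.transpose i j) (map_pmf inv (law t)))"
    unfolding shuffle_Suc_commute map_bind_pmf
  proof (intro bind_pmf_cong refl, clarify)
    fix i j :: nat
    show "map_pmf inv (map_pmf (\<lambda>\<sigma>. Transposition.transpose i j \<circ> \<sigma>) (law t)) =
      map_pmf (\<lambda>\<sigma>. \<sigma> \<circ> Transposition.transpose i j) (map_pmf inv (law t))"
      unfolding map_pmf_comp
    proof (intro map_pmf_cong refl)
      fix \<sigma> assume "\<sigma> \<in> set_pmf (law t)"
      then have "bij \<sigma>" using law_permutes permutes_bij by blast
      then show "inv (Transposition.transpose i j \<circ> \<sigma>) = inv \<sigma> \<circ> Transposition.transpose i j"
        by (simp add: o_inv_distrib)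
    qed
  qed
  also have "\<dots> = law (t + 1)"
    unfolding shuffle_add Suc by (simp add: shuffle_step_def bind_return_pmf bind_map_pmf split_def)
  finally show ?case by simp
qed

text \<open>Since the law of the walk is invariant under inversion, returning after \<open>2 s\<close> steps means that two
  independent copies agree after \<open>s\<close> steps.\<close>

lemma move_prob_double:
  fixes R s
  assumes R: "R \<subseteq> U"
  defines "\<nu> \<equiv> map_pmf (\<lambda>\<sigma>. restrict \<sigma> R) (law s)"
  shows "move_prob (s + s) R id = (\<Sum>y\<in>R \<rightarrow>\<^sub>E U. (pmf \<nu> y)\<^sup>2)"
proof -
  have fin: "finite R" using R finite_subset by blast
  have sub: "set_pmf \<nu> \<subseteq> R \<rightarrow>\<^sub>E U"
  proof
    fix y assume "y \<in> set_pmf \<nu>"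
    then obtain \<sigma> where s: "\<sigma> \<in> set_pmf (law s)" "y = restrict \<sigma> R" by (auto simp: \<nu>_def)
    have "\<sigma> x \<in> U" if "x \<in> R" for x
      using permutes_in_image[OF law_permutes[OF s(1)], of x] that R by blast
    then show "y \<in> R \<rightarrow>\<^sub>E U" unfolding s(2) by auto
  qed
  \<comment> \<open>\<open>inv \<pi> \<circ> \<sigma>\<close> fixes \<open>R\<close> pointwise iff
    \<open>\<pi>\<close> and \<open>\<sigma>\<close> agree on \<open>R\<close>. Bijectivity of
    \<open>\<pi>\<close> is known only on the support of \<open>law s\<close>, hence the almost sure
    comparison.\<close>
  have pr: "measure_pmf.prob (law s) {\<pi>. (inv \<pi> \<circ> \<sigma>) \<in> {\<sigma>. \<forall>i\<in>R. \<sigma> i = id i}} = pmf \<nu> (restrict \<sigma> R)" for \<sigma>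
  proof -
    have "measure_pmf.prob (law s) {\<pi>. (inv \<pi> \<circ> \<sigma>) \<in> {\<sigma>. \<forall>i\<in>R. \<sigma> i = id i}} =
      measure_pmf.prob (law s) ((\<lambda>\<sigma>. restrict \<sigma> R) -` {restrict \<sigma> R})"
    proof (rule measure_pmf.finite_measure_eq_AE)
      show "AE \<pi> in measure_pmf (law s). (\<pi> \<in> {\<pi>. (inv \<pi> \<circ> \<sigma>) \<in> {\<sigma>. \<forall>i\<in>R. \<sigma> i = id i}}) =
         (\<pi> \<in> (\<lambda>\<sigma>. restrict \<sigma> R) -` {restrict \<sigma> R})"
        unfolding AE_measure_pmf_iff
      proof
        fix \<pi> assume "\<pi> \<in> set_pmf (law s)"
        then have "bij \<pi>" using law_permutes permutes_bij by blast
        then have "(inv \<pi> (\<sigma> i) = i) = (\<pi> i = \<sigma> i)" for i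
          by (metis bij_inv_eq_iff)
        then show "(\<pi> \<in> {\<pi>. (inv \<pi> \<circ> \<sigma>) \<in> {\<sigma>. \<forall>i\<in>R. \<sigma> i = id i}}) =
         (\<pi> \<in> (\<lambda>\<sigma>. restrict \<sigma> R) -` {restrict \<sigma> R})"
          by (auto simp: fun_eq_iff restrict_def)
      qed
    qed auto
    then show ?thesis unfolding \<nu>_def pmf_map by simp
  qed
  have "move_prob (s + s) R id = measure_pmf.expectation (law s) (\<lambda>\<sigma>.
      measure_pmf.prob (map_pmf (\<lambda>\<pi>. \<pi> \<circ> \<sigma>) (map_pmf inv (law s))) {\<sigma>. \<forall>i\<in>R. \<sigma> i = id i})"
    unfolding move_prob_def shuffle_add measure_bind_pmf map_inv_law ..
  also have "\<dots> = measure_pmf.expectation (law s) (\<lambda>\<sigma>. pmf \<nu> (restrict \<sigma> R))"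
    unfolding pr[symmetric] by (simp add: vimage_def map_pmf_comp)
  also have "\<dots> = measure_pmf.expectation \<nu> (pmf \<nu>)"
    unfolding \<nu>_def by simp
  also have "\<dots> = (\<Sum>y\<in>R \<rightarrow>\<^sub>E U. pmf \<nu> y * pmf \<nu> y)"
    using sub fin by (intro integral_measure_pmf_real) (auto intro: finite_PiE)
  finally show ?thesis by (simp add: power2_eq_square)
qed

text \<open>The restrictions to \<open>R\<close> are sorted into cells \<open>Y S\<close> by their
  fixed set. A cell has at most \<open>(2 * n) ^ card (R - S)\<close> elements, so by Cauchy-Schwarz
  its squares sum to at least its squared mass divided by that number; cells with \<open>S\<close>
  not inside \<open>B\<close> are dropped.\<close>

lemma move_prob_double_ge:
  assumes R: "R \<subseteq> U"
  shows "(\<Sum>S\<in>Pow (R \<inter> B). (max 0 (move_prob s S id - (\<Sum>i\<in>R - S. move_prob s (insert i S) id)))\<^sup>2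
     / (2 * real n) ^ card (R - S)) \<le> move_prob (s + s) R id"
proof -
  define \<nu> where "\<nu> = map_pmf (\<lambda>\<sigma>. restrict \<sigma> R) (law s)"
  define Y where "Y S = {y \<in> R \<rightarrow>\<^sub>E U. {i \<in> R. y i = i} = S}" for S
  have fin: "finite R" using R finite_subset by blast
  have finP: "finite (R \<rightarrow>\<^sub>E U)" using fin by (intro finite_PiE) auto
  have finY: "finite (Y S)" for S unfolding Y_def using finP by auto
  have cell: "(max 0 (move_prob s S id - (\<Sum>i\<in>R - S. move_prob s (insert i S) id)))\<^sup>2 / (2 * real n) ^ card (R - S)
     \<le> (\<Sum>y\<in>Y S. (pmf \<nu> y)\<^sup>2)" if S: "S \<subseteq> R" for S
  proof -
    let ?E = "\<lambda>S. {\<sigma>. \<forall>i\<in>S. \<sigma> i = id i} :: (nat \<Rightarrow> nat) set"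
    have "Y S \<subseteq> (\<lambda>z i. if i \<in> S then i else z i) ` ((R - S) \<rightarrow>\<^sub>E U)"
    proof
      fix y assume y: "y \<in> Y S"
      have "y = (\<lambda>i. if i \<in> S then i else restrict y (R - S) i)"
        using y S by (auto simp: Y_def fun_eq_iff restrict_def PiE_def extensional_def)
      moreover have "restrict y (R - S) \<in> (R - S) \<rightarrow>\<^sub>E U" using y by (auto simp: Y_def)
      ultimately show "y \<in> (\<lambda>z i. if i \<in> S then i else z i) ` ((R - S) \<rightarrow>\<^sub>E U)" by blast
    qed
    then have "card (Y S) \<le> card ((R - S) \<rightarrow>\<^sub>E U)"
      using fin by (intro surj_card_le finite_PiE) auto
    then have "card (Y S) \<le> (2 * n) ^ card (R - S)" using fin by (simp add: card_PiE)
    then have "real (card (Y S)) \<le> real ((2 * n) ^ card (R - S))" by (rule of_nat_mono)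
    then have cY: "real (card (Y S)) \<le> (2 * real n) ^ card (R - S)" by simp
    have nuY: "(\<Sum>y\<in>Y S. pmf \<nu> y) = measure_pmf.prob (law s) {\<sigma>. {i \<in> R. \<sigma> i = i} = S}"
    proof -
      have "(\<Sum>y\<in>Y S. pmf \<nu> y) = measure_pmf.prob \<nu> (Y S)"
        using finY by (simp add: measure_measure_pmf_finite)
      also have "\<dots> = measure_pmf.prob (law s) ((\<lambda>\<sigma>. restrict \<sigma> R) -` Y S)"
        by (simp add: \<nu>_def)
      also have "\<dots> = measure_pmf.prob (law s) {\<sigma>. {i \<in> R. \<sigma> i = i} = S}"
      proof (rule measure_pmf.finite_measure_eq_AE)
        show "AE \<sigma> in measure_pmf (law s). (\<sigma> \<in> (\<lambda>\<sigma>. restrict \<sigma> R) -` Y S) = (\<sigma> \<in> {\<sigma>. {i \<in> R. \<sigma> i = i} = S})"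
          unfolding AE_measure_pmf_iff
        proof
          fix \<sigma> assume s: "\<sigma> \<in> set_pmf (law s)"
          have "\<sigma> x \<in> U" if "x \<in> R" for x
            using permutes_in_image[OF law_permutes[OF s], of x] that R by blast
          then have "restrict \<sigma> R \<in> R \<rightarrow>\<^sub>E U" by auto
          moreover have "{i \<in> R. restrict \<sigma> R i = i} = {i \<in> R. \<sigma> i = i}" by auto
          ultimately show "(\<sigma> \<in> (\<lambda>\<sigma>. restrict \<sigma> R) -` Y S) = (\<sigma> \<in> {\<sigma>. {i \<in> R. \<sigma> i = i} = S})"
            by (simp only: Y_def vimage_def mem_Collect_eq) simp
        qed
      qed auto
      finally show ?thesis .
    qed
    \<comment> \<open>Union bound: if \<open>S\<close> is fixed, then it is the whole fixed set
      within \<open>R\<close> or some further \<open>i\<close> is fixed as well. This bounds the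
      mass of the cell from below.\<close>
    have "measure_pmf.prob (law s) (?E S) \<le> measure_pmf.prob (law s) ({\<sigma>. {i \<in> R. \<sigma> i = i} = S} \<union> (\<Union>i\<in>R - S. ?E (insert i S)))"
      using S by (intro measure_pmf.finite_measure_mono) auto
    also have "\<dots> \<le> measure_pmf.prob (law s) {\<sigma>. {i \<in> R. \<sigma> i = i} = S} + measure_pmf.prob (law s) (\<Union>i\<in>R - S. ?E (insert i S))"
      by (rule measure_Un_le) auto
    also have "measure_pmf.prob (law s) (\<Union>i\<in>R - S. ?E (insert i S)) \<le> (\<Sum>i\<in>R - S. measure_pmf.prob (law s) (?E (insert i S)))"
      using fin by (intro measure_pmf.finite_measure_subadditive_finite) auto
    finally have "move_prob s S id - (\<Sum>i\<in>R - S. move_prob s (insert i S) id) \<le> (\<Sum>y\<in>Y S. pmf \<nu> y)"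
      unfolding move_prob_def nuY by simp
    then have "max 0 (move_prob s S id - (\<Sum>i\<in>R - S. move_prob s (insert i S) id)) \<le> (\<Sum>y\<in>Y S. pmf \<nu> y)"
      by (simp add: sum_nonneg)
    then have "(max 0 (move_prob s S id - (\<Sum>i\<in>R - S. move_prob s (insert i S) id)))\<^sup>2 \<le> (\<Sum>y\<in>Y S. pmf \<nu> y)\<^sup>2"
      by (intro power_mono) auto
    also have "\<dots> \<le> (\<Sum>y\<in>Y S. (pmf \<nu> y)\<^sup>2) * card (Y S)" by (rule sum_squared_le_sum_of_squares)
    also have "\<dots> \<le> (\<Sum>y\<in>Y S. (pmf \<nu> y)\<^sup>2) * (2 * real n) ^ card (R - S)"
      using cY by (intro mult_left_mono sum_nonneg) auto
    finally show ?thesis using n_pos by (simp add: divide_le_eq)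
  qed
  have "(\<Sum>S\<in>Pow (R \<inter> B). (max 0 (move_prob s S id - (\<Sum>i\<in>R - S. move_prob s (insert i S) id)))\<^sup>2
     / (2 * real n) ^ card (R - S)) \<le> (\<Sum>S\<in>Pow (R \<inter> B). \<Sum>y\<in>Y S. (pmf \<nu> y)\<^sup>2)"
    by (intro sum_mono cell) auto
  also have "\<dots> = (\<Sum>y\<in>(\<Union>S\<in>Pow (R \<inter> B). Y S). (pmf \<nu> y)\<^sup>2)"
    using fin finY by (intro sum.UNION_disjoint[symmetric]) (auto simp: Y_def)
  also have "\<dots> \<le> (\<Sum>y\<in>R \<rightarrow>\<^sub>E U. (pmf \<nu> y)\<^sup>2)"
    using finP by (intro sum_mono2) (auto simp: Y_def)
  also have "\<dots> = move_prob (s + s) R id" unfolding \<nu>_def by (rule move_prob_double[OF R, symmetric])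
  finally show ?thesis .
qed

end

section \<open>Summation of the cell bounds over all tracked sets\<close>

lemma card_supersets:
  assumes "finite X" "S \<subseteq> X" "card S \<le> k"
  shows "card {R. R \<subseteq> X \<and> card R = k \<and> S \<subseteq> R} = (card X - card S) choose (k - card S)"
proof -
  have fS: "finite S" using assms finite_subset by blast
  have "bij_betw (\<lambda>T. T \<union> S) {T. T \<subseteq> X - S \<and> card T = k - card S} {R. R \<subseteq> X \<and> card R = k \<and> S \<subseteq> R}"
  proof (rule bij_betwI[where g = "\<lambda>R. R - S"])
    show "(\<lambda>T. T \<union> S) \<in> {T. T \<subseteq> X - S \<and> card T = k - card S} \<rightarrow> {R. R \<subseteq> X \<and> card R = k \<and> S \<subseteq> R}"
    proof
      fix T assume T: "T \<in> {T. T \<subseteq> X - S \<and> card T = k - card S}"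
      then have "finite T" "T \<inter> S = {}" using assms finite_subset by auto
      then have "card (T \<union> S) = k" using T fS assms by (simp add: card_Un_disjoint)
      then show "T \<union> S \<in> {R. R \<subseteq> X \<and> card R = k \<and> S \<subseteq> R}" using T assms by auto
    qed
    show "(\<lambda>R. R - S) \<in> {R. R \<subseteq> X \<and> card R = k \<and> S \<subseteq> R} \<rightarrow> {T. T \<subseteq> X - S \<and> card T = k - card S}"
      using fS by (auto simp: card_Diff_subset)
  qed auto
  then have "card {R. R \<subseteq> X \<and> card R = k \<and> S \<subseteq> R} = card {T. T \<subseteq> X - S \<and> card T = k - card S}"
    by (simp add: bij_betw_same_card)
  also have "\<dots> = card (X - S) choose (k - card S)" using assms by (intro n_subsets) auto
  finally show ?thesis using assms fS by (simp add: card_Diff_subset)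
qed

text \<open>A lower bound for the probability that, after half of \<open>t\<close> steps, a given set of \<open>j\<close> cards of \<open>B\<close> is
  exactly the set of fixed cards among \<open>k\<close> tracked ones.\<close>

definition cell_lower :: "real \<Rightarrow> nat \<Rightarrow> nat \<Rightarrow> nat \<Rightarrow> nat \<Rightarrow> real" where
  "cell_lower b n k t j = max 0 ((1 - real j * b / real (2 * n)) ^ t
     - real k * ((1 + swap_error n (Suc j) (t div 2) * fact (Suc j)) * entry_bound b n (Suc j) (t div 2) ^ Suc j))"

context biased_deck
begin

lemma entry_bound_nonneg: "0 \<le> entry_bound b n k t"
proof -
  have "b / n \<le> 1 / 1" using b_le_1 n_pos b_pos by (intro frac_le) auto
  then show ?thesis unfolding entry_bound_def by (intro add_nonneg_nonneg zero_le_power) simp_all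
qed

text \<open>\<open>S\<close> is fixed if it is never drawn, and its cards have weight
  \<open>b / (2 * n)\<close> each. Each of the at most \<open>k\<close> further cards is charged
  with the upper bound for \<open>j + 1\<close> fixed cards, where
  \<open>j = card S\<close>.\<close>

lemma cell_lower_le:
  assumes R: "R \<subseteq> U" "card R = k" and S: "S \<subseteq> R \<inter> B"
    and n: "4 * Suc k \<le> n" and t: "16 * Suc k * t \<le> n\<^sup>2"
  shows "cell_lower b n k t (card S) \<le> max 0 (move_prob (t div 2) S id - (\<Sum>i\<in>R - S. move_prob (t div 2) (insert i S) id))"
proof -
  let ?j = "card S" and ?s = "t div 2"
  let ?G = "(1 + swap_error n (Suc ?j) ?s * fact (Suc ?j)) * entry_bound b n (Suc ?j) ?s ^ Suc ?j"
  have SR: "S \<subseteq> R" using S by blast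
  have fR: "finite R" by (rule finite_subset[OF R(1)]) simp
  have fin: "finite R" "finite S" using fR finite_subset[OF SR fR] by auto
  have SU: "S \<subseteq> U" using R(1) S by blast
  have jk: "?j \<le> k" using card_mono[OF fR SR] R(2) by simp
  have "sum p S = (\<Sum>i\<in>S. b / (2 * n))"
  proof (rule sum.cong[OF refl])
    fix i assume "i \<in> S"
    then have "i \<in> B" "i \<notin> A" using S AB(2) by blast+
    then show "p i = b / (2 * n)" by (simp add: p_def)
  qed
  then have pS: "sum p S = ?j * b / (2 * n)" by simp
  have base: "0 \<le> 1 - ?j * b / (2 * n)" "1 - ?j * b / (2 * n) \<le> 1"
  proof -
    have "?j \<le> 2 * n" using jk n by arith
    then have "real ?j \<le> real (2 * n)" by (rule of_nat_mono)
    then have "real ?j * b \<le> real (2 * n) * 1"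
      using b_le_1 b_pos by (intro mult_mono) simp_all
    then have "real ?j * b / (2 * n) \<le> real (2 * n) * 1 / real (2 * n)"
      by (intro divide_right_mono) simp_all
    then show "0 \<le> 1 - ?j * b / (2 * n)" using n_pos by simp
    show "1 - ?j * b / (2 * n) \<le> 1" using b_pos by simp
  qed
  \<comment> \<open>The base lies in \<open>[0, 1]\<close> and \<open>2 * (t div 2)\<close> is at
    most \<open>t\<close>, so the exponent \<open>t\<close> serves both parities.\<close>
  have "(1 - ?j * b / (2 * n)) ^ t \<le> (1 - ?j * b / (2 * n)) ^ (2 * ?s)"
    by (rule power_decreasing[OF _ base]) simp
  also have "\<dots> \<le> move_prob ?s S id" using move_prob_id_ge[OF SU, of ?s] by (simp only: pS)
  finally have 1: "(1 - ?j * b / (2 * n)) ^ t \<le> move_prob ?s S id" .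
  have G0: "0 \<le> ?G" using swap_error_nonneg entry_bound_nonneg by (intro mult_nonneg_nonneg add_nonneg_nonneg) auto
  have "(\<Sum>i\<in>R - S. move_prob ?s (insert i S) id) \<le> (\<Sum>i\<in>R - S. ?G)"
  proof (rule sum_mono)
    fix i assume i: "i \<in> R - S"
    have "16 * Suc ?j * ?s \<le> 16 * Suc k * t" using jk by (intro mult_le_mono) auto
    then have t': "16 * Suc ?j * ?s \<le> n\<^sup>2" using t by (rule le_trans)
    have "insert i S \<subseteq> U" "card (insert i S) = Suc ?j" using i R SU fin by auto
    moreover have "4 \<le> n" "4 * Suc ?j \<le> n" using n jk by arith+
    ultimately show "move_prob ?s (insert i S) id \<le> ?G"
      using t' by (intro move_prob_id_le_entry_bound)
  qed
  also have "\<dots> \<le> k * ?G"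
  proof -
    have "card (R - S) \<le> k" using R fin by (metis card_mono Diff_subset)
    then show ?thesis using G0 by (simp add: mult_right_mono)
  qed
  finally show ?thesis using 1 unfolding cell_lower_def by (intro max.mono) auto
qed

text \<open>Double counting of pairs \<open>S \<subseteq> R\<close>: each \<open>S\<close> in
  \<open>B\<close> of size \<open>j\<close> lies in \<open>(2 * n - j) choose (k - j)\<close>
  tracked sets \<open>R\<close>.\<close>

lemma sum_move_prob_ge:
  assumes n: "4 * Suc k \<le> n" and t: "16 * Suc k * t \<le> n\<^sup>2"
  shows "(1 - k / n)\<^sup>2 * (\<Sum>j\<le>k. real (n choose j) * real ((2 * n - j) choose (k - j)) / (2 * real n) ^ (k - j) * (cell_lower b n k t j)\<^sup>2)
    \<le> (\<Sum>R | R \<subseteq> U \<and> card R = k. move_prob t R id)"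
proof -
  let ?s = "t div 2"
  let ?Q = "{R. R \<subseteq> U \<and> card R = k}"
  define g where "g S = (cell_lower b n k t (card S))\<^sup>2 / (2 * real n) ^ (k - card S)" for S :: "nat set"
  have g0: "0 \<le> g S" for S unfolding g_def by simp
  have finQ: "finite ?Q" by simp
  \<comment> \<open>For odd \<open>t\<close> one step remains after the doubled half time; it avoids
    all tracked cards with probability at least \<open>(1 - k / n)\<^sup>2\<close>. For even
    \<open>t\<close> this factor only weakens the bound.\<close>
  have double: "(1 - k / n)\<^sup>2 * move_prob (?s + ?s) R id \<le> move_prob t R id" if R: "R \<in> ?Q" for R
  proof -
    have "sum p R \<le> (\<Sum>i\<in>R. 1 / real n)" by (intro sum_mono p_le)
    then have pR: "sum p R \<le> k / n" using R by simp
    have kn: "k / n \<le> 1" using n n_pos by simp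
    show ?thesis
    proof (cases "even t")
      case True
      then have "?s + ?s = t" by auto
      moreover have "(1 - k / n)\<^sup>2 \<le> 1" using kn by (intro power_le_one) auto
      ultimately show ?thesis using move_prob_nonneg[of t R id] by (simp add: mult_left_le_one_le)
    next
      case False
      then have t: "t = Suc (?s + ?s)" by presburger
      have "(1 - k / n)\<^sup>2 * move_prob (?s + ?s) R id \<le> (1 - sum p R)\<^sup>2 * move_prob (?s + ?s) R id"
        using pR kn move_prob_nonneg by (intro mult_right_mono power_mono) auto
      also have "\<dots> \<le> move_prob (Suc (?s + ?s)) R id" using R by (intro move_prob_id_Suc_ge) auto
      finally show ?thesis using t by simp
    qed
  qed
  have low: "(\<Sum>S\<in>Pow (R \<inter> B). g S) \<le> move_prob (?s + ?s) R id" if R: "R \<in> ?Q" for R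
  proof -
    have fin: "finite R" using R finite_subset by blast
    have "(\<Sum>S\<in>Pow (R \<inter> B). g S) \<le> (\<Sum>S\<in>Pow (R \<inter> B).
       (max 0 (move_prob ?s S id - (\<Sum>i\<in>R - S. move_prob ?s (insert i S) id)))\<^sup>2 / (2 * real n) ^ card (R - S))"
    proof (rule sum_mono)
      fix S assume S: "S \<in> Pow (R \<inter> B)"
      then have c: "card (R - S) = k - card S" using R fin finite_subset by (subst card_Diff_subset) auto
      have "(cell_lower b n k t (card S))\<^sup>2 \<le> (max 0 (move_prob ?s S id - (\<Sum>i\<in>R - S. move_prob ?s (insert i S) id)))\<^sup>2"
        using R S n t by (intro power_mono cell_lower_le) (auto simp: cell_lower_def)
      then show "g S \<le> (max 0 (move_prob ?s S id - (\<Sum>i\<in>R - S. move_prob ?s (insert i S) id)))\<^sup>2 / (2 * real n) ^ card (R - S)"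
        unfolding g_def c by (intro divide_right_mono) auto
    qed
    also have "\<dots> \<le> move_prob (?s + ?s) R id" using R by (intro move_prob_double_ge) auto
    finally show ?thesis .
  qed
  have "(\<Sum>j\<le>k. real (n choose j) * real ((2 * n - j) choose (k - j)) / (2 * real n) ^ (k - j) * (cell_lower b n k t j)\<^sup>2)
     = (\<Sum>j\<le>k. \<Sum>S | S \<subseteq> B \<and> card S = j. real ((2 * n - card S) choose (k - card S)) * g S)"
  proof (intro sum.cong refl)
    fix j
    have "(\<Sum>S | S \<subseteq> B \<and> card S = j. real ((2 * n - card S) choose (k - card S)) * g S) =
      (\<Sum>S | S \<subseteq> B \<and> card S = j. real ((2 * n - j) choose (k - j)) * ((cell_lower b n k t j)\<^sup>2 / (2 * real n) ^ (k - j)))"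
      by (intro sum.cong refl) (auto simp: g_def)
    also have "\<dots> = real (n choose j) * (real ((2 * n - j) choose (k - j)) * ((cell_lower b n k t j)\<^sup>2 / (2 * real n) ^ (k - j)))"
      using fin_AB card_AB by (simp add: n_subsets)
    finally show "real (n choose j) * real ((2 * n - j) choose (k - j)) / (2 * real n) ^ (k - j) * (cell_lower b n k t j)\<^sup>2 =
      (\<Sum>S | S \<subseteq> B \<and> card S = j. real ((2 * n - card S) choose (k - card S)) * g S)" by simp
  qed
  also have "\<dots> = (\<Sum>S\<in>(\<Union>j\<in>{..k}. {S. S \<subseteq> B \<and> card S = j}). real ((2 * n - card S) choose (k - card S)) * g S)"
    using fin_AB by (intro sum.UNION_disjoint[symmetric]) auto
  also have "\<dots> = (\<Sum>S\<in>(\<Union>j\<in>{..k}. {S. S \<subseteq> B \<and> card S = j}). \<Sum>R | R \<in> ?Q \<and> S \<subseteq> R. g S)"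
  proof (intro sum.cong refl)
    fix S assume S: "S \<in> (\<Union>j\<in>{..k}. {S. S \<subseteq> B \<and> card S = j})"
    then have "S \<subseteq> U" using AB by auto
    then show "real ((2 * n - card S) choose (k - card S)) * g S = (\<Sum>R | R \<in> ?Q \<and> S \<subseteq> R. g S)"
      using card_supersets[of U S k] S by (simp add: conj_assoc)
  qed
  also have "\<dots> \<le> (\<Sum>S\<in>Pow B. \<Sum>R | R \<in> ?Q \<and> S \<subseteq> R. g S)"
    using fin_AB by (intro sum_mono2 sum_nonneg g0) auto
  also have "\<dots> = (\<Sum>R\<in>?Q. \<Sum>S | S \<in> Pow B \<and> S \<subseteq> R. g S)"
    using fin_AB by (intro sum.swap_restrict) auto
  also have "\<dots> = (\<Sum>R\<in>?Q. \<Sum>S\<in>Pow (R \<inter> B). g S)"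
    by (intro sum.cong refl) auto
  also have "\<dots> \<le> (\<Sum>R\<in>?Q. move_prob (?s + ?s) R id)" by (intro sum_mono low)
  finally have "(1 - k / n)\<^sup>2 * (\<Sum>j\<le>k. real (n choose j) * real ((2 * n - j) choose (k - j)) / (2 * real n) ^ (k - j) * (cell_lower b n k t j)\<^sup>2)
     \<le> (1 - k / n)\<^sup>2 * (\<Sum>R\<in>?Q. move_prob (?s + ?s) R id)"
    by (rule mult_left_mono) simp
  also have "\<dots> \<le> (\<Sum>R\<in>?Q. move_prob t R id)"
    unfolding sum_distrib_left by (intro sum_mono double)
  finally show ?thesis .
qed

end

section \<open>Asymptotics at the time of the theorem\<close>

text \<open>With \<open>N = 2 * n\<close> and \<open>T\<close> steps,
  \<open>T * ln (1 - \<alpha> / N)\<close> is \<open>- \<alpha> / (2 * b) * (ln N - c)\<close> up to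
  a vanishing error.\<close>

lemma power_num_steps_tendsto:
  fixes \<alpha> b c :: real
  assumes \<alpha>: "\<alpha> > 0" and b: "b > 0"
  shows "(\<lambda>n. real (2 * n) powr (\<alpha> / (2 * b)) * (1 - \<alpha> / real (2 * n)) ^ num_steps b c (2 * n)) \<longlonglongrightarrow> exp (c * \<alpha> / (2 * b))"
proof -
  define f where "f n = 1 / (2 * b) * real (2 * n) * (ln (real (2 * n)) - c)" for n :: nat
  define L where "L n = ln (1 - \<alpha> / real (2 * n))" for n :: nat
  have lim1: "(\<lambda>n. \<alpha> / (2 * b) * ln (real (2 * n)) + f n * L n) \<longlonglongrightarrow> c * \<alpha> / (2 * b)"
    unfolding f_def L_def using \<alpha> b by real_asymp (simp add: field_simps)
  \<comment> \<open>Rounding puts \<open>num_steps\<close> between \<open>f n - 1\<close> and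
    \<open>f n\<close>; since \<open>L n\<close> is eventually nonpositive, the two limits enclose
    the exponent.\<close>
  have lim2: "(\<lambda>n. \<alpha> / (2 * b) * ln (real (2 * n)) + (f n - 1) * L n) \<longlonglongrightarrow> c * \<alpha> / (2 * b)"
    unfolding f_def L_def using \<alpha> b by real_asymp (simp add: field_simps)
  have ev: "\<forall>\<^sub>F n in sequentially. 0 \<le> f n \<and> \<alpha> / real (2 * n) < 1 \<and> n > 0"
  proof (intro eventually_conj)
    show "\<forall>\<^sub>F n in sequentially. 0 \<le> f n" unfolding f_def using b by real_asymp
    show "\<forall>\<^sub>F n in sequentially. \<alpha> / real (2 * n) < 1" using \<alpha> by real_asymp
    show "\<forall>\<^sub>F n :: nat in sequentially. n > 0" by (rule eventually_gt_at_top)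
  qed
  have "(\<lambda>n. \<alpha> / (2 * b) * ln (real (2 * n)) + real (num_steps b c (2 * n)) * L n) \<longlonglongrightarrow> c * \<alpha> / (2 * b)"
  proof (rule tendsto_sandwich[OF _ _ lim1 lim2])
    have *: "f n * L n \<le> real (num_steps b c (2 * n)) * L n \<and> real (num_steps b c (2 * n)) * L n \<le> (f n - 1) * L n"
      if "0 \<le> f n \<and> \<alpha> / real (2 * n) < 1 \<and> n > 0" for n
    proof -
      have "0 < \<alpha> / real (2 * n)" using \<alpha> that by simp
      then have "L n \<le> 0" unfolding L_def using that by (intro ln_le_zero_iff[THEN iffD2]) linarith+
      moreover have "real (num_steps b c (2 * n)) \<le> f n" "f n - 1 \<le> real (num_steps b c (2 * n))"
        using that unfolding num_steps_def f_def[symmetric] by linarith+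
      ultimately show ?thesis by (simp add: mult_right_mono_neg)
    qed
    show "\<forall>\<^sub>F n in sequentially. \<alpha> / (2 * b) * ln (real (2 * n)) + f n * L n \<le> \<alpha> / (2 * b) * ln (real (2 * n)) + real (num_steps b c (2 * n)) * L n"
      using ev by eventually_elim (use * in auto)
    show "\<forall>\<^sub>F n in sequentially. \<alpha> / (2 * b) * ln (real (2 * n)) + real (num_steps b c (2 * n)) * L n \<le> \<alpha> / (2 * b) * ln (real (2 * n)) + (f n - 1) * L n"
      using ev by eventually_elim (use * in auto)
  qed
  then have "(\<lambda>n. exp (\<alpha> / (2 * b) * ln (real (2 * n)) + real (num_steps b c (2 * n)) * L n)) \<longlonglongrightarrow> exp (c * \<alpha> / (2 * b))"
    by (rule tendsto_exp)
  then show ?thesis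
  proof (rule Lim_transform_eventually)
    show "\<forall>\<^sub>F n in sequentially. exp (\<alpha> / (2 * b) * ln (real (2 * n)) + real (num_steps b c (2 * n)) * L n) =
      real (2 * n) powr (\<alpha> / (2 * b)) * (1 - \<alpha> / real (2 * n)) ^ num_steps b c (2 * n)"
      using ev
    proof eventually_elim
      case (elim n)
      then show ?case
        by (simp add: exp_add powr_def L_def exp_of_nat_mult)
    qed
  qed
qed

lemma num_steps_div_square_tendsto:
  assumes "b > 0"
  shows "(\<lambda>n. real (num_steps b c (2 * n)) / real n ^ 2) \<longlonglongrightarrow> 0"
proof (rule tendsto_sandwich[of "\<lambda>n. 0"])
  have ev: "\<forall>\<^sub>F n in sequentially. 0 \<le> 1 / (2 * b) * real (2 * n) * (ln (real (2 * n)) - c)"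
    using assms by real_asymp
  show "\<forall>\<^sub>F n in sequentially. real (num_steps b c (2 * n)) / real n ^ 2 \<le> (1 / (2 * b) * real (2 * n) * (ln (real (2 * n)) - c)) / real n ^ 2"
    using ev
  proof eventually_elim
    case (elim n)
    then have "real (num_steps b c (2 * n)) \<le> 1 / (2 * b) * real (2 * n) * (ln (real (2 * n)) - c)"
      unfolding num_steps_def by linarith
    then show ?case by (intro divide_right_mono) auto
  qed
  show "(\<lambda>n. (1 / (2 * b) * real (2 * n) * (ln (real (2 * n)) - c)) / real n ^ 2) \<longlonglongrightarrow> 0"
    using assms by real_asymp
qed auto

lemma choose_div_pow_tendsto:
  fixes m :: "nat \<Rightarrow> nat" and y :: "nat \<Rightarrow> real" and L :: real
  assumes "\<And>i. (\<lambda>n. (real (m n) - real i) / y n) \<longlonglongrightarrow> L"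
  shows "(\<lambda>n. real (m n choose k) / y n ^ k) \<longlonglongrightarrow> L ^ k / fact k"
proof -
  have "(\<lambda>n. (\<Prod>i = 0..<k. (real (m n) - real i) / y n) / fact k) \<longlonglongrightarrow> (\<Prod>i = 0..<k. L) / fact k"
    by (intro tendsto_divide tendsto_prod tendsto_const assms) auto
  moreover have "(\<lambda>n. (\<Prod>i = 0..<k. (real (m n) - real i) / y n) / fact k) = (\<lambda>n. real (m n choose k) / y n ^ k)"
    by (simp add: binomial_gbinomial gbinomial_prod_rev prod_dividef mult.commute)
  ultimately show ?thesis by simp
qed

text \<open>By \<open>1 + x \<le> exp x\<close> the compounded error is at most
  \<open>exp (?C * (t / n\<^sup>2)) - 1\<close>, and the number of steps is
  \<open>o(n\<^sup>2)\<close>.\<close>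

lemma swap_error_num_steps_tendsto:
  assumes "b > 0"
  shows "(\<lambda>n. swap_error n k (num_steps b c (2 * n))) \<longlonglongrightarrow> 0"
proof (rule tendsto_sandwich[of "\<lambda>n. 0"])
  let ?C = "real k ^ 2 * (2 + 2 ^ k)"
  show "\<forall>\<^sub>F n in sequentially. 0 \<le> swap_error n k (num_steps b c (2 * n))"
    by (intro always_eventually allI) (simp add: swap_error_def one_le_power)
  have "swap_error n k t \<le> exp (?C * (real t / real n ^ 2)) - 1" for n t
  proof -
    have "(1 + (real k / real n)\<^sup>2 * (2 + 2 ^ k)) ^ t \<le> exp ((real k / real n)\<^sup>2 * (2 + 2 ^ k)) ^ t"
      by (intro power_mono exp_ge_add_one_self) auto
    also have "\<dots> = exp (?C * (real t / real n ^ 2))"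
      by (simp add: power_divide mult_ac flip: exp_of_nat_mult)
    finally show ?thesis by (simp add: swap_error_def)
  qed
  then show "\<forall>\<^sub>F n in sequentially. swap_error n k (num_steps b c (2 * n)) \<le> exp (?C * (real (num_steps b c (2 * n)) / real n ^ 2)) - 1"
    by (intro always_eventually allI)
  have "(\<lambda>n. exp (?C * (real (num_steps b c (2 * n)) / real n ^ 2)) - 1) \<longlonglongrightarrow> exp (?C * 0) - 1"
    by (intro tendsto_intros num_steps_div_square_tendsto assms)
  then show "(\<lambda>n. exp (?C * (real (num_steps b c (2 * n)) / real n ^ 2)) - 1) \<longlonglongrightarrow> 0" by simp
qed auto

text \<open>The rate \<open>\<alpha> = 2 * b\<close> is critical: the decay has order exactly
  \<open>1 / N\<close>, so the \<open>n\<close> cards of \<open>B\<close> contribute a finite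
  positive amount.\<close>

lemma holding_power_tendsto:
  assumes "b > 0"
  shows "(\<lambda>n. real (2 * n) * (1 - b / real n) ^ num_steps b c (2 * n)) \<longlonglongrightarrow> exp c"
proof -
  have "(\<lambda>n. real (2 * n) powr (2 * b / (2 * b)) * (1 - 2 * b / real (2 * n)) ^ num_steps b c (2 * n)) \<longlonglongrightarrow> exp (c * (2 * b) / (2 * b))"
    by (rule power_num_steps_tendsto) (use assms in auto)
  then show ?thesis using assms by simp
qed

lemma entry_bound_num_steps_tendsto:
  assumes "b > 0"
  shows "(\<lambda>n. 2 * real n * entry_bound b n k (num_steps b c (2 * n))) \<longlonglongrightarrow> exp c + 2"
proof -
  have "(\<lambda>n. real (2 * n) * (1 - b / real n) ^ num_steps b c (2 * n) + 2 + 32 * real k * (real (num_steps b c (2 * n)) / real n ^ 2))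
     \<longlonglongrightarrow> exp c + 2 + 32 * real k * 0"
    by (intro tendsto_intros holding_power_tendsto num_steps_div_square_tendsto assms)
  then have "(\<lambda>n. real (2 * n) * (1 - b / real n) ^ num_steps b c (2 * n) + 2 + 32 * real k * (real (num_steps b c (2 * n)) / real n ^ 2))
     \<longlonglongrightarrow> exp c + 2" by simp
  then show ?thesis
    by (rule Lim_transform_eventually)
       (use eventually_gt_at_top[of 0] in eventually_elim, simp add: entry_bound_def field_simps power2_eq_square power3_eq_cube)
qed

text \<open>Of the trace, only the eigenvalue \<open>1\<close> and the part of \<open>B\<close>
  survive. The \<open>\<rho>\<close> part decays like \<open>N powr (- a)\<close> and the part of
  \<open>A\<close> like \<open>N powr (1 - a / b)\<close>, which vanishes because
  \<open>b < a\<close>.\<close>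

lemma upper_moment_bound_tendsto:
  fixes a b c :: real
  assumes b: "0 < b" and ba: "b < a"
  defines "T \<equiv> \<lambda>n. num_steps b c (2 * n)"
  shows "(\<lambda>n. (1 + (1 - a * b / real n) ^ T n + (real n - 1) * ((1 - a / real n) ^ T n + (1 - b / real n) ^ T n)
        + 32 * real k * real (T n) / real n ^ 2) ^ k / fact k
      + swap_error n k (T n) * (2 * real n * entry_bound b n k (T n)) ^ k) \<longlonglongrightarrow> (1 + 1 / 2 * exp c) ^ k / fact k"
proof -
  have a0: "0 < a" using b ba by simp
  have rho: "(\<lambda>n. (1 - a * b / real n) ^ T n) \<longlonglongrightarrow> 0"
  proof -
    have "(\<lambda>n. (real (2 * n) powr (2 * (a * b) / (2 * b)) * (1 - 2 * (a * b) / real (2 * n)) ^ T n) * real (2 * n) powr (- a)) \<longlonglongrightarrow> exp (c * (2 * (a * b)) / (2 * b)) * 0"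
      unfolding T_def
    proof (intro tendsto_mult power_num_steps_tendsto)
      show "(\<lambda>n. real (2 * n) powr (- a)) \<longlonglongrightarrow> 0" using a0 by real_asymp
    qed (use a0 b in auto)
    then have "(\<lambda>n. (real (2 * n) powr (2 * (a * b) / (2 * b)) * (1 - 2 * (a * b) / real (2 * n)) ^ T n) * real (2 * n) powr (- a)) \<longlonglongrightarrow> 0"
      by simp
    then show ?thesis
      by (rule Lim_transform_eventually)
         (use eventually_gt_at_top[of 0] in eventually_elim, use b in \<open>simp add: powr_minus field_simps\<close>)
  qed
  have dA: "(\<lambda>n. (real n - 1) * (1 - a / real n) ^ T n) \<longlonglongrightarrow> 0"
  proof -
    have "(\<lambda>n. (real (2 * n) powr (2 * a / (2 * b)) * (1 - 2 * a / real (2 * n)) ^ T n) * ((real n - 1) * real (2 * n) powr (- (a / b)))) \<longlonglongrightarrow> exp (c * (2 * a) / (2 * b)) * 0"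
      unfolding T_def
    proof (intro tendsto_mult power_num_steps_tendsto)
      have "1 < a / b" using ba b by simp
      then show "(\<lambda>n. (real n - 1) * real (2 * n) powr (- (a / b))) \<longlonglongrightarrow> 0" by real_asymp
    qed (use a0 b in auto)
    then have "(\<lambda>n. (real (2 * n) powr (2 * a / (2 * b)) * (1 - 2 * a / real (2 * n)) ^ T n) * ((real n - 1) * real (2 * n) powr (- (a / b)))) \<longlonglongrightarrow> 0"
      by simp
    then show ?thesis
      by (rule Lim_transform_eventually)
         (use eventually_gt_at_top[of 0] in eventually_elim, use b in \<open>simp add: powr_minus field_simps\<close>)
  qed
  have dB: "(\<lambda>n. (real n - 1) * (1 - b / real n) ^ T n) \<longlonglongrightarrow> 1 / 2 * exp c"
  proof -
    have "(\<lambda>n. (real n - 1) / real (2 * n) * (real (2 * n) * (1 - b / real n) ^ T n)) \<longlonglongrightarrow> 1 / 2 * exp c"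
      unfolding T_def
    proof (intro tendsto_mult holding_power_tendsto b)
      show "(\<lambda>n. (real n - 1) / real (2 * n)) \<longlonglongrightarrow> 1 / 2" by real_asymp
    qed
    then show ?thesis
      by (rule Lim_transform_eventually) (use eventually_gt_at_top[of 0] in eventually_elim, simp)
  qed
  have E: "(\<lambda>n. swap_error n k (T n)) \<longlonglongrightarrow> 0"
    unfolding T_def by (rule swap_error_num_steps_tendsto[OF b])
  have M: "(\<lambda>n. 2 * real n * entry_bound b n k (T n)) \<longlonglongrightarrow> exp c + 2"
    unfolding T_def by (rule entry_bound_num_steps_tendsto[OF b])
  have Q: "(\<lambda>n. real (T n) / real n ^ 2) \<longlonglongrightarrow> 0"
    unfolding T_def by (rule num_steps_div_square_tendsto[OF b])
  have "(\<lambda>n. (1 + (1 - a * b / real n) ^ T n + ((real n - 1) * (1 - a / real n) ^ T n + (real n - 1) * (1 - b / real n) ^ T n)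
        + 32 * real k * (real (T n) / real n ^ 2)) ^ k / fact k
      + swap_error n k (T n) * (2 * real n * entry_bound b n k (T n)) ^ k) \<longlonglongrightarrow>
      (1 + 0 + (0 + 1 / 2 * exp c) + 32 * real k * 0) ^ k / fact k + 0 * (exp c + 2) ^ k"
  proof (intro tendsto_add tendsto_divide tendsto_power)
    show "(\<lambda>n. swap_error n k (T n) * (2 * real n * entry_bound b n k (T n)) ^ k) \<longlonglongrightarrow> 0 * (exp c + 2) ^ k"
      by (rule tendsto_mult[OF E tendsto_power[OF M]])
    show "(\<lambda>n. 32 * real k * (real (T n) / (real n)\<^sup>2)) \<longlonglongrightarrow> 32 * real k * 0"
      by (rule tendsto_mult[OF tendsto_const Q])
  qed (use rho dA dB in simp_all)
  then show ?thesis by (simp add: distrib_left)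
qed


section \<open>Lower moment bound at the time of the theorem\<close>

lemma swap_error_mono: "s \<le> t \<Longrightarrow> swap_error n k s \<le> swap_error n k t"
  unfolding swap_error_def by (intro diff_right_mono power_increasing) simp_all

text \<open>At half time an entry is at most of order \<open>N powr (- 1 / 2)\<close>, so
  \<open>j + 1\<close> fixed cards cost \<open>N powr (- (j + 1) / 2)\<close>, smaller than the main
  term \<open>N powr (- j / 2)\<close> by \<open>N powr (- 1 / 2)\<close>.\<close>

lemma half_time_error_tendsto:
  fixes b c :: real
  assumes b: "0 < b"
  defines "T \<equiv> \<lambda>n. num_steps b c (2 * n)"
  shows "(\<lambda>n. real (2 * n) powr (real j / 2) * ((1 + swap_error n (Suc j) (T n div 2) * fact (Suc j)) * entry_bound b n (Suc j) (T n div 2) ^ Suc j)) \<longlonglongrightarrow> 0"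
proof -
  let ?D = "\<lambda>n. (1 - b / real n)"
  define bnd where "bnd n = sqrt (2 * (real (2 * n) * ?D n ^ T n)) + sqrt (real (2 * n)) / real n
     + sqrt (real (2 * n)) / real n * (16 * real (Suc j) * (real (T n) / real n ^ 2))" for n
  have sn: "(\<lambda>n. sqrt (real (2 * n)) / real n) \<longlonglongrightarrow> 0" by real_asymp
  have Q: "(\<lambda>n. real (T n) / real n ^ 2) \<longlonglongrightarrow> 0"
    unfolding T_def by (rule num_steps_div_square_tendsto[OF b])
  have H: "(\<lambda>n. real (2 * n) * ?D n ^ T n) \<longlonglongrightarrow> exp c"
    unfolding T_def by (rule holding_power_tendsto[OF b])
  have bndlim: "bnd \<longlonglongrightarrow> sqrt (2 * exp c) + 0 + 0 * (16 * real (Suc j) * 0)"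
    unfolding bnd_def by (intro tendsto_add tendsto_mult[OF sn tendsto_mult[OF tendsto_const Q]] sn tendsto_real_sqrt tendsto_mult[OF tendsto_const H])
  have le: "sqrt (real (2 * n)) * entry_bound b n (Suc j) (T n div 2) \<le> bnd n" if n: "n > 0" "2 * b \<le> real n" for n
  proof -
    have D: "1 / 2 \<le> ?D n" "?D n \<le> 1" using n b by (auto simp: field_simps)
    \<comment> \<open>Halving loses one step when \<open>T n\<close> is odd; since
      \<open>1 / 2 \<le> ?D n\<close>, the factor 2 makes up for it.\<close>
    have "?D n ^ (2 * (T n div 2)) \<le> 2 * ?D n ^ T n"
    proof (cases "even (T n)")
      case True
      have "0 \<le> ?D n ^ T n" using D by (intro zero_le_power) linarith
      then show ?thesis using True by simp
    next
      case False
      then have "T n = Suc (2 * (T n div 2))" by presburger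
      then have "2 * ?D n ^ T n = (2 * ?D n) * ?D n ^ (2 * (T n div 2))"
        by (metis mult.assoc power_Suc)
      moreover have "1 * ?D n ^ (2 * (T n div 2)) \<le> (2 * ?D n) * ?D n ^ (2 * (T n div 2))"
      proof (rule mult_right_mono[OF _ zero_le_power])
        have "1 / 2 \<le> x \<Longrightarrow> 1 \<le> 2 * x" for x :: real by simp
        then show "1 \<le> 2 * ?D n" using D(1) .
        show "0 \<le> ?D n" by (rule order_trans[OF _ D(1)]) simp
      qed
      ultimately show ?thesis by simp
    qed
    then have "real (2 * n) * (?D n ^ (T n div 2))\<^sup>2 \<le> 2 * (real (2 * n) * ?D n ^ T n)"
      by (simp add: mult.left_commute mult_left_mono flip: power_mult mult.commute[of 2 "T n div 2"])
    then have "sqrt (real (2 * n) * (?D n ^ (T n div 2))\<^sup>2) \<le> sqrt (2 * (real (2 * n) * ?D n ^ T n))"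
      by (rule real_sqrt_le_mono)
    then have 1: "sqrt (real (2 * n)) * ?D n ^ (T n div 2) \<le> sqrt (2 * (real (2 * n) * ?D n ^ T n))"
      using D by (simp add: real_sqrt_mult)
    have "real (T n div 2) \<le> real (T n)" by simp
    then have "16 * real (Suc j) * real (T n div 2) / real n ^ 3 \<le> 16 * real (Suc j) * real (T n) / real n ^ 3"
      by (intro divide_right_mono mult_left_mono) auto
    then have "sqrt (real (2 * n)) * (16 * real (Suc j) * real (T n div 2) / real n ^ 3)
       \<le> sqrt (real (2 * n)) * (16 * real (Suc j) * real (T n) / real n ^ 3)"
      by (intro mult_left_mono) auto
    also have "\<dots> = sqrt (real (2 * n)) / real n * (16 * real (Suc j) * (real (T n) / real n ^ 2))"
      by (simp add: power2_eq_square power3_eq_cube)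
    finally show ?thesis using 1 unfolding entry_bound_def bnd_def by (simp add: distrib_left)
  qed
  define E where "E n = 1 + swap_error n (Suc j) (T n) * fact (Suc j)" for n
  have Elim: "E \<longlonglongrightarrow> 1 + 0 * fact (Suc j)"
    unfolding E_def T_def by (intro tendsto_add tendsto_mult tendsto_const swap_error_num_steps_tendsto[OF b])
  have inv: "(\<lambda>n. 1 / sqrt (real (2 * n))) \<longlonglongrightarrow> 0" by real_asymp
  have "(\<lambda>n. E n * bnd n ^ Suc j * (1 / sqrt (real (2 * n)))) \<longlonglongrightarrow>
      (1 + 0 * fact (Suc j)) * (sqrt (2 * exp c) + 0 + 0 * (16 * real (Suc j) * 0)) ^ Suc j * 0"
    by (intro tendsto_mult[OF tendsto_mult[OF Elim tendsto_power[OF bndlim]] inv])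
  then have up: "(\<lambda>n. E n * bnd n ^ Suc j * (1 / sqrt (real (2 * n)))) \<longlonglongrightarrow> 0" by simp
  have ev: "\<forall>\<^sub>F n in sequentially. n > 0 \<and> 2 * b \<le> real n"
    by (intro eventually_conj eventually_gt_at_top) real_asymp
  show ?thesis
  proof (rule tendsto_sandwich[OF _ _ tendsto_const up])
    have e0: "0 \<le> swap_error n k t" for n k t by (simp add: swap_error_def one_le_power)
    have M0: "0 \<le> entry_bound b n k t" if "n > 0 \<and> 2 * b \<le> real n" for n k t
      using that b unfolding entry_bound_def by (intro add_nonneg_nonneg zero_le_power) (auto simp: field_simps)
    show "\<forall>\<^sub>F n in sequentially. 0 \<le> real (2 * n) powr (real j / 2) * ((1 + swap_error n (Suc j) (T n div 2) * fact (Suc j)) * entry_bound b n (Suc j) (T n div 2) ^ Suc j)"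
      using ev by eventually_elim (intro mult_nonneg_nonneg add_nonneg_nonneg e0 zero_le_power M0; simp)
    show "\<forall>\<^sub>F n in sequentially. real (2 * n) powr (real j / 2) * ((1 + swap_error n (Suc j) (T n div 2) * fact (Suc j)) * entry_bound b n (Suc j) (T n div 2) ^ Suc j)
        \<le> E n * bnd n ^ Suc j * (1 / sqrt (real (2 * n)))"
      using ev
    proof eventually_elim
      case (elim n)
      let ?M = "entry_bound b n (Suc j) (T n div 2)" and ?e = "1 + swap_error n (Suc j) (T n div 2) * fact (Suc j)"
      have r: "0 < sqrt (real (2 * n))" using elim by simp
      have pw: "real (2 * n) powr (real j / 2) = sqrt (real (2 * n)) ^ j"
        using elim by (simp add: powr_half_sqrt[symmetric] powr_powr flip: powr_realpow)
      have "real (2 * n) powr (real j / 2) * (?e * ?M ^ Suc j) = ?e * (sqrt (real (2 * n)) * ?M) ^ Suc j * (1 / sqrt (real (2 * n)))"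
        unfolding pw power_mult_distrib using r by (simp add: field_simps)
      also have "\<dots> \<le> E n * bnd n ^ Suc j * (1 / sqrt (real (2 * n)))"
      proof (intro mult_right_mono mult_mono power_mono)
        show "?e \<le> E n" unfolding E_def by (intro add_left_mono mult_right_mono swap_error_mono) auto
        show "sqrt (real (2 * n)) * ?M \<le> bnd n" using le elim by blast
        show "0 \<le> E n" unfolding E_def by (intro add_nonneg_nonneg mult_nonneg_nonneg e0) auto
        show "0 \<le> sqrt (real (2 * n)) * ?M" using r M0[OF elim] by (intro mult_nonneg_nonneg) auto
        then show "0 \<le> (sqrt (real (2 * n)) * ?M) ^ Suc j" by (rule zero_le_power)
        show "0 \<le> 1 / sqrt (real (2 * n))" by simp
      qed
      finally show ?case .
    qed
  qed
qed

text \<open>The rate \<open>\<alpha> = j * b\<close> makes the main term decay like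
  \<open>N powr (- j / 2)\<close>. The weight \<open>N powr (j / 2)\<close>, with square
  \<open>N ^ j\<close>, passes through the maximum because it is nonnegative.\<close>

lemma cell_lower_tendsto:
  fixes b c :: real
  assumes b: "0 < b"
  shows "(\<lambda>n. real (2 * n) ^ j * (cell_lower b n k (num_steps b c (2 * n)) j)\<^sup>2) \<longlonglongrightarrow> exp c ^ j"
proof -
  let ?T = "\<lambda>n. num_steps b c (2 * n)"
  let ?w = "\<lambda>n. real (2 * n) powr (real j / 2)"
  have main: "(\<lambda>n. ?w n * (1 - real j * b / real (2 * n)) ^ ?T n) \<longlonglongrightarrow> exp (c * real j / 2)"
  proof (cases "j = 0")
    \<comment> \<open>Separate because \<open>power_num_steps_tendsto\<close> requires a positive
      rate.\<close>
    case True
    have "(\<lambda>n. 1) \<longlonglongrightarrow> exp (c * real j / 2)" using True by simp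
    then show ?thesis
      by (rule Lim_transform_eventually)
         (use eventually_gt_at_top[of 0] in eventually_elim, use True in simp)
  next
    case False
    then show ?thesis
      using power_num_steps_tendsto[of "real j * b" b c] b by (simp add: mult.assoc)
  qed
  have "(\<lambda>n. (max 0 (?w n * (1 - real j * b / real (2 * n)) ^ ?T n - real k *
     (?w n * ((1 + swap_error n (Suc j) (?T n div 2) * fact (Suc j)) * entry_bound b n (Suc j) (?T n div 2) ^ Suc j))))\<^sup>2)
     \<longlonglongrightarrow> (max 0 (exp (c * real j / 2) - real k * 0))\<^sup>2"
    by (intro tendsto_power tendsto_max tendsto_diff tendsto_mult[OF tendsto_const half_time_error_tendsto[OF b]] tendsto_const main)
  also have "(max 0 (exp (c * real j / 2) - real k * 0))\<^sup>2 = exp c ^ j"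
    by (simp add: max_def power2_eq_square flip: exp_add exp_of_nat_mult)
  finally show ?thesis
  proof (rule Lim_transform_eventually)
    show "\<forall>\<^sub>F n in sequentially. (max 0 (?w n * (1 - real j * b / real (2 * n)) ^ ?T n - real k *
     (?w n * ((1 + swap_error n (Suc j) (?T n div 2) * fact (Suc j)) * entry_bound b n (Suc j) (?T n div 2) ^ Suc j))))\<^sup>2
      = real (2 * n) ^ j * (cell_lower b n k (?T n) j)\<^sup>2"
      using eventually_gt_at_top[of 0]
    proof eventually_elim
      case (elim n)
      define w x y where "w = ?w n" and "x = (1 - real j * b / real (2 * n)) ^ ?T n"
        and "y = real k * ((1 + swap_error n (Suc j) (?T n div 2) * fact (Suc j)) * entry_bound b n (Suc j) (?T n div 2) ^ Suc j)"
      have w0: "0 \<le> w" unfolding w_def by simp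
      have w2: "w\<^sup>2 = real (2 * n) ^ j"
      proof -
        have "w\<^sup>2 = real (2 * n) powr real j"
          unfolding w_def by (simp add: power2_eq_square del: of_nat_mult flip: powr_add)
        also have "\<dots> = real (2 * n) ^ j" using elim by (intro powr_realpow) simp
        finally show ?thesis .
      qed
      have "max 0 (w * x - w * y) = w * max 0 (x - y)"
        using w0 by (simp add: max_mult_distrib_left right_diff_distrib)
      then have "(max 0 (w * x - w * y))\<^sup>2 = w\<^sup>2 * (max 0 (x - y))\<^sup>2" by (simp add: power_mult_distrib)
      then show ?case
        unfolding w2 unfolding cell_lower_def w_def x_def y_def by (simp only: mult.left_commute)
    qed
  qed
qed

text \<open>In each summand the powers of \<open>N = 2 * n\<close> balance: the first coefficient
  gives \<open>(1 / 2) ^ j / fact j\<close>, the second \<open>1 / fact (k - j)\<close>, the squared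
  cell bound \<open>exp c ^ j\<close>. The limits add up by the binomial theorem.\<close>

lemma lower_moment_bound_tendsto:
  fixes b c :: real
  assumes b: "0 < b"
  shows "(\<lambda>n. (1 - real k / real n)\<^sup>2 * (\<Sum>j\<le>k. real (n choose j) * real ((2 * n - j) choose (k - j)) / (2 * real n) ^ (k - j)
      * (cell_lower b n k (num_steps b c (2 * n)) j)\<^sup>2)) \<longlonglongrightarrow> (1 + 1 / 2 * exp c) ^ k / fact k"
proof -
  let ?C = "\<lambda>n j. cell_lower b n k (num_steps b c (2 * n)) j"
  have c1: "(\<lambda>n. real (n choose j) / real (2 * n) ^ j) \<longlonglongrightarrow> (1 / 2) ^ j / fact j" for j
    by (rule choose_div_pow_tendsto) real_asymp
  have c2: "(\<lambda>n. real ((2 * n - j) choose m) / real (2 * n) ^ m) \<longlonglongrightarrow> 1 ^ m / fact m" for j m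
  proof (rule choose_div_pow_tendsto)
    fix i
    have "(\<lambda>n. (real (2 * n) - real j - real i) / real (2 * n)) \<longlonglongrightarrow> 1" by real_asymp
    then show "(\<lambda>n. (real (2 * n - j) - real i) / real (2 * n)) \<longlonglongrightarrow> 1"
      by (rule Lim_transform_eventually)
         (use eventually_ge_at_top[of j] in eventually_elim, simp add: of_nat_diff)
  qed
  have c3: "(\<lambda>n. 1 - real k / real n) \<longlonglongrightarrow> 1" by real_asymp
  have "(\<lambda>n. (1 - real k / real n)\<^sup>2 * (\<Sum>j\<le>k. (real (n choose j) / real (2 * n) ^ j) *
      (real ((2 * n - j) choose (k - j)) / real (2 * n) ^ (k - j)) * (real (2 * n) ^ j * (?C n j)\<^sup>2)))
      \<longlonglongrightarrow> 1\<^sup>2 * (\<Sum>j\<le>k. ((1 / 2) ^ j / fact j) * (1 ^ (k - j) / fact (k - j)) * exp c ^ j)"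
    by (intro tendsto_mult tendsto_power c3 tendsto_sum c1 c2 cell_lower_tendsto[OF b])
  also have "1\<^sup>2 * (\<Sum>j\<le>k. ((1 / 2) ^ j / fact j) * (1 ^ (k - j) / fact (k - j)) * exp c ^ j)
     = (1 / 2 * exp c + 1) ^ k / fact k"
    unfolding binomial_ring sum_divide_distrib
    by (simp add: binomial_fact power_mult_distrib power_divide mult_ac)
  also have "(1 / 2 * exp c + 1) = 1 + 1 / 2 * exp c" by simp
  finally show ?thesis
  proof (rule Lim_transform_eventually)
    show "\<forall>\<^sub>F n in sequentially. (1 - real k / real n)\<^sup>2 * (\<Sum>j\<le>k. (real (n choose j) / real (2 * n) ^ j) *
      (real ((2 * n - j) choose (k - j)) / real (2 * n) ^ (k - j)) * (real (2 * n) ^ j * (?C n j)\<^sup>2)) =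
      (1 - real k / real n)\<^sup>2 * (\<Sum>j\<le>k. real (n choose j) * real ((2 * n - j) choose (k - j)) / (2 * real n) ^ (k - j) * (?C n j)\<^sup>2)"
      using eventually_gt_at_top[of 0]
    proof eventually_elim
      case (elim n)
      show ?case
        by (rule arg_cong[where f = "\<lambda>z. (1 - real k / real n)\<^sup>2 * z"], rule sum.cong[OF refl])
           (use elim in simp)
    qed
  qed
qed


section \<open>Binomial moments of the two fixed point laws\<close>

lemma finite_set_map_num_fixed: "finite (set_pmf (map_pmf (num_fixed N) M))"
proof (rule finite_subset)
  have "num_fixed N \<sigma> \<le> card {1..N}" for \<sigma> unfolding num_fixed_def by (intro card_mono) auto
  then show "set_pmf (map_pmf (num_fixed N) M) \<subseteq> {..card {1..N}}" by auto
qed simp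

text \<open>The permutations fixing \<open>S\<close> pointwise are those of its complement, so each
  moment agrees exactly with that of \<open>poisson_pmf 1\<close> once
  \<open>k \<le> N\<close>.\<close>

lemma binomial_moment_Fix_unif:
  assumes "k \<le> N"
  shows "measure_pmf.expectation (Fix_unif N) (\<lambda>x. real (x choose k)) = 1 / fact k"
proof -
  let ?P = "{\<sigma>. \<sigma> permutes {1..N}}"
  have fin: "finite ?P" by (simp add: finite_permutations)
  have ne: "?P \<noteq> {}" using permutes_id by blast
  have "measure_pmf.expectation (Fix_unif N) (\<lambda>x. real (x choose k)) =
    (\<Sum>S | S \<subseteq> {1..N} \<and> card S = k. measure_pmf.prob (pmf_of_set ?P) {\<sigma>. \<forall>i\<in>S. \<sigma> i = i})"
    unfolding Fix_unif_def by (rule expectation_num_fixed_choose) (simp only: set_pmf_of_set[OF ne fin] fin)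
  also have "\<dots> = (\<Sum>S | S \<subseteq> {1..N} \<and> card S = k. fact (N - k) / fact N)"
  proof (rule sum.cong[OF refl])
    fix S assume S: "S \<in> {S. S \<subseteq> {1..N} \<and> card S = k}"
    then have fS: "finite S" using finite_subset[of S "{1..N}"] by simp
    have "?P \<inter> {\<sigma>. \<forall>i\<in>S. \<sigma> i = i} = {\<sigma>. \<sigma> permutes ({1..N} - S)}"
    proof (intro equalityI subsetI)
      fix \<sigma> assume "\<sigma> \<in> ?P \<inter> {\<sigma>. \<forall>i\<in>S. \<sigma> i = i}"
      then show "\<sigma> \<in> {\<sigma>. \<sigma> permutes ({1..N} - S)}" by (auto intro: permutes_superset)
    next
      fix \<sigma> assume "\<sigma> \<in> {\<sigma>. \<sigma> permutes ({1..N} - S)}"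
      then have s: "\<sigma> permutes ({1..N} - S)" by simp
      then have "\<sigma> permutes {1..N}" by (rule permutes_subset) auto
      moreover have "\<forall>i\<in>S. \<sigma> i = i" using permutes_not_in[OF s] by auto
      ultimately show "\<sigma> \<in> ?P \<inter> {\<sigma>. \<forall>i\<in>S. \<sigma> i = i}" by simp
    qed
    moreover have "card ({1..N} - S) = N - k" using S fS by (simp add: card_Diff_subset)
    ultimately have "card (?P \<inter> {\<sigma>. \<forall>i\<in>S. \<sigma> i = i}) = fact (N - k)"
      by (simp add: card_permutations)
    moreover have "card ?P = fact N" by (simp add: card_permutations)
    ultimately show "measure_pmf.prob (pmf_of_set ?P) {\<sigma>. \<forall>i\<in>S. \<sigma> i = i} = fact (N - k) / fact N"
      unfolding measure_pmf_of_set[OF ne fin] by simp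
  qed
  also have "\<dots> = real (N choose k) * (fact (N - k) / fact N)" by (simp add: n_subsets)
  also have "\<dots> = 1 / fact k" using assms by (simp add: binomial_fact)
  finally show ?thesis .
qed

text \<open>A sandwich between \<open>sum_move_prob_ge\<close> and \<open>sum_move_prob_le\<close>,
  whose side conditions hold for large \<open>n\<close> because the number of steps is
  \<open>o(n\<^sup>2)\<close>.\<close>

lemma binomial_moment_Fix_shuffle_tendsto:
  fixes a b c :: real and A B :: "nat \<Rightarrow> nat set"
  assumes b: "0 < b" "b < 1" and ab: "a + b = 2"
    and AB: "\<And>n. A n \<union> B n = {1..2 * n}" "\<And>n. A n \<inter> B n = {}" "\<And>n. card (A n) = n" "\<And>n. card (B n) = n"
  shows "(\<lambda>n. measure_pmf.expectation (Fix_shuffle a b c (2 * n) (A n) (B n)) (\<lambda>x. real (x choose k)))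
    \<longlonglongrightarrow> (1 + 1 / 2 * exp c) ^ k / fact k"
proof -
  let ?T = "\<lambda>n. num_steps b c (2 * n)"
  have ba: "b < a" using b ab by simp
  have deck: "biased_deck a b n (A n) (B n)" if "n > 0" for n
    using that b ba ab AB by unfold_locales auto
  have mom: "measure_pmf.expectation (Fix_shuffle a b c (2 * n) (A n) (B n)) (\<lambda>x. real (x choose k)) =
     (\<Sum>S | S \<subseteq> {1..2 * n} \<and> card S = k. biased_deck.move_prob a b n (A n) (B n) (?T n) S id)" if "n > 0" for n
  proof -
    interpret biased_deck a b n "A n" "B n" using deck that .
    show ?thesis unfolding Fix_shuffle_def move_prob_def
      by (subst expectation_num_fixed_choose[OF finite_law]) simp
  qed
  have ev: "\<forall>\<^sub>F n in sequentially. 4 * Suc k \<le> n \<and> 16 * Suc k * ?T n \<le> n\<^sup>2"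
  proof (intro eventually_conj eventually_ge_at_top)
    have "\<forall>\<^sub>F n in sequentially. real (?T n) / real n ^ 2 < 1 / (16 * real (Suc k))"
      by (rule order_tendstoD(2)[OF num_steps_div_square_tendsto[OF b(1)]]) simp
    then show "\<forall>\<^sub>F n in sequentially. 16 * Suc k * ?T n \<le> n\<^sup>2"
      using eventually_gt_at_top[of 0]
    proof eventually_elim
      case (elim n)
      then have "16 * real (Suc k) * real (?T n) \<le> real n ^ 2" by (simp add: field_simps del: of_nat_Suc)
      then have "real (16 * Suc k * ?T n) \<le> real (n\<^sup>2)" by simp
      then show ?case by (simp only: of_nat_le_iff)
    qed
  qed
  show ?thesis
  proof (rule tendsto_sandwich[OF _ _ lower_moment_bound_tendsto[OF b(1)] upper_moment_bound_tendsto[OF b(1) ba]])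
    show "\<forall>\<^sub>F n in sequentially. (1 - real k / real n)\<^sup>2 * (\<Sum>j\<le>k. real (n choose j) * real ((2 * n - j) choose (k - j)) / (2 * real n) ^ (k - j)
      * (cell_lower b n k (?T n) j)\<^sup>2) \<le> measure_pmf.expectation (Fix_shuffle a b c (2 * n) (A n) (B n)) (\<lambda>x. real (x choose k))"
      using ev
    proof eventually_elim
      case (elim n)
      then have n: "n > 0" by simp
      interpret biased_deck a b n "A n" "B n" using deck n .
      show ?case unfolding mom[OF n] using elim by (intro sum_move_prob_ge) auto
    qed
    show "\<forall>\<^sub>F n in sequentially. measure_pmf.expectation (Fix_shuffle a b c (2 * n) (A n) (B n)) (\<lambda>x. real (x choose k))
      \<le> (1 + (1 - a * b / real n) ^ ?T n + (real n - 1) * ((1 - a / real n) ^ ?T n + (1 - b / real n) ^ ?T n)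
        + 32 * real k * real (?T n) / real n ^ 2) ^ k / fact k
      + swap_error n k (?T n) * (2 * real n * entry_bound b n k (?T n)) ^ k"
      using ev
    proof eventually_elim
      case (elim n)
      then have n: "n > 0" by simp
      interpret biased_deck a b n "A n" "B n" using deck n .
      have "4 \<le> n" "4 * k \<le> n" using elim by auto
      moreover have "16 * k * ?T n \<le> n\<^sup>2" using elim by (auto intro: le_trans[rotated])
      ultimately show ?case unfolding mom[OF n] using sum_move_prob_le[of k "?T n"] by (simp add: \<rho>_def d_def)
    qed
  qed
qed

theorem theorem1p3:
  fixes a b c :: real and A B :: "nat \<Rightarrow> nat set"
  assumes "0 < b" and "b \<le> a" and "a + b = 2"
    and "\<And>n. A n \<union> B n = {1..2 * n}" and "\<And>n. A n \<inter> B n = {}"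
    and "\<And>n. card (A n) = n" and "\<And>n. card (B n) = n"
    and "b < 1"
  shows "converges_in_dist (\<lambda>n. Fix_shuffle a b c (2 * n) (A n) (B n))
           (poisson_pmf (1 + 1 / 2 * exp c))
       \<and> (\<lambda>n. d_TV (Fix_shuffle a b c (2 * n) (A n) (B n)) (Fix_unif (2 * n)))
           \<longlonglongrightarrow> d_TV (poisson_pmf 1) (poisson_pmf (1 + 1 / 2 * exp c))"
proof -
  have shuf: "(\<lambda>n. pmf (Fix_shuffle a b c (2 * n) (A n) (B n)) j) \<longlonglongrightarrow> pmf (poisson_pmf (1 + 1 / 2 * exp c)) j" for j
  proof (rule pmf_tendsto_poisson_of_binomial_moments)
    show "finite (set_pmf (Fix_shuffle a b c (2 * n) (A n) (B n)))" for n
      unfolding Fix_shuffle_def by (rule finite_set_map_num_fixed)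
    show "0 < 1 + 1 / 2 * exp c" by (simp add: add_pos_pos)
    show "(\<lambda>n. measure_pmf.expectation (Fix_shuffle a b c (2 * n) (A n) (B n)) (\<lambda>x. real (x choose k)))
      \<longlonglongrightarrow> (1 + 1 / 2 * exp c) ^ k / fact k" for k
      by (intro binomial_moment_Fix_shuffle_tendsto assms)
  qed
  have unif: "(\<lambda>n. pmf (Fix_unif (2 * n)) j) \<longlonglongrightarrow> pmf (poisson_pmf 1) j" for j
  proof (rule pmf_tendsto_poisson_of_binomial_moments)
    show "finite (set_pmf (Fix_unif (2 * n)))" for n
      unfolding Fix_unif_def by (rule finite_set_map_num_fixed)
    show "(\<lambda>n. measure_pmf.expectation (Fix_unif (2 * n)) (\<lambda>x. real (x choose k))) \<longlonglongrightarrow> 1 ^ k / fact k" for k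
    proof (rule tendsto_eventually)
      show "\<forall>\<^sub>F n in sequentially. measure_pmf.expectation (Fix_unif (2 * n)) (\<lambda>x. real (x choose k)) = 1 ^ k / fact k"
        using eventually_ge_at_top[of k] by eventually_elim (simp add: binomial_moment_Fix_unif)
    qed
  qed simp
  \<comment> \<open>The arguments are exchanged so that the limit appears in the order of the claim;
    symmetry of \<open>d_TV\<close> settles the rest.\<close>
  have "(\<lambda>n. d_TV (Fix_unif (2 * n)) (Fix_shuffle a b c (2 * n) (A n) (B n)))
      \<longlonglongrightarrow> d_TV (poisson_pmf 1) (poisson_pmf (1 + 1 / 2 * exp c))"
    by (rule d_TV_tendsto[OF unif shuf])
  then show ?thesis
    using converges_in_distI[OF shuf] by (simp add: d_TV_def abs_minus_commute)
qed

end
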